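(* Let $K$ be a finite extension of $F$ of degree $r$, let $U$ be a compact open subset of $K$ and let $f : U \to K$ be a strictly differentiable function such that $(f(x), f'(x)) \neq (0,0)$ for all $x \in U$. Then $$\#f^{-1}(0) = \lim_{s\to\infty} q^{sr}\int_U \|f'(x)\|^r\cdot \mathbb{1}_{\{\|f(x)\|\leq q^{-s}\}}\, dx.$$
   Context: Let $p$ be a prime and $F$ a finite extension of $\mathbb{Q}_p$ whose residue field has cardinality $q$. Let $\|\cdot\|$ be the absolute value on an algebraic closure of $F$ normalized by $\|p\| = p^{-[F:\mathbb{Q}_p]}$. For a finite extension $K$ of $F$, $dx$ denotes the Haar measure $\lambda_K$ on $K$ normalized by $\lambda_K(\mathcal{O}_K)=1$. A function $f:U\to K$ is strictly differentiable if for every $a\in U$ the quotient $\frac{f(x)-f(y)}{x-y}$ tends to a limit $f'(a)$ as $(x,y)\to(a,a)$ with $x\neq y$. *)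

theory Defs
  imports "HOL-Analysis.Analysis" "HOL-Algebra.Algebraic_Closure_Type"
begin

text \<open>
  Everything lives inside one ambient field with an absolute value, which the theorem takes to
  be an algebraic closure of \<open>F\<close>. Since \<open>absv x = dist x 0\<close>, definiteness and the triangle
  inequality of the absolute value come from the metric axioms, and the topology of the type is
  the one defined by the absolute value.
\<close>

class abs_valued_field = field_char_0 + metric_space +
  fixes absv :: "'a \<Rightarrow> real"
  assumes dist_absv: "dist x y = absv (x - y)"
    and absv_mult: "absv (x * y) = absv x * absv y"

abbreviation ambient :: "'a::abs_valued_field ring" where
  "ambient \<equiv> ring_of_type_algebra"

definition finite_extension_degree :: "'a::abs_valued_field set \<Rightarrow> 'a set \<Rightarrow> nat \<Rightarrow> bool" where
  "finite_extension_degree F K n \<longleftrightarrow>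
     subfield F ambient \<and> subfield K ambient \<and> F \<subseteq> K \<and> ring.dimension ambient n F K"

definition padic_abs :: "nat \<Rightarrow> rat \<Rightarrow> real" where
  "padic_abs p x =
     (if x = 0 then 0
      else real p powi (int (multiplicity (int p) (snd (quotient_of x)))
                        - int (multiplicity (int p) (fst (quotient_of x)))))"

text \<open>
  \<open>Q\<close> is a copy of the field of \<open>p\<close>-adic numbers: a completion of the rationals for the
  \<open>p\<close>-adic absolute value. The ambient absolute value is only required to restrict to a positive
  power of the \<open>p\<close>-adic one, because its normalisation depends on \<open>F\<close>.
\<close>

definition padic_numbers :: "nat \<Rightarrow> 'a::abs_valued_field set \<Rightarrow> bool" where
  "padic_numbers p Q \<longleftrightarrow>
     subfield Q ambient \<and> complete Q \<and> Q = closure \<rat> \<and>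
     (\<exists>c>0. \<forall>x. absv (of_rat x :: 'a) = padic_abs p x powr c)"

definition integer_ring :: "'a::abs_valued_field set \<Rightarrow> 'a set" where
  "integer_ring K = {x \<in> K. absv x \<le> 1}"

definition maximal_ideal :: "'a::abs_valued_field set \<Rightarrow> 'a set" where
  "maximal_ideal K = {x \<in> K. absv x < 1}"

definition residue_field :: "'a::abs_valued_field set \<Rightarrow> 'a set ring" where
  "residue_field K = (ambient\<lparr>carrier := integer_ring K\<rparr>) Quot (maximal_ideal K)"

text \<open>
  No regularity condition is imposed: a finite extension of the \<open>p\<close>-adic numbers is locally
  compact and second countable, so finiteness on compact sets already implies regularity.
\<close>

definition haar_measure_on :: "'a::abs_valued_field set \<Rightarrow> 'a measure \<Rightarrow> bool" where
  "haar_measure_on K M \<longleftrightarrow>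
     sets M = sets (restrict_space borel K) \<and>
     emeasure M K \<noteq> 0 \<and>
     (\<forall>C. compact C \<and> C \<subseteq> K \<longrightarrow> emeasure M C < \<infinity>) \<and>
     (\<forall>a\<in>K. \<forall>A\<in>sets M. emeasure M ((+) a ` A) = emeasure M A)"

definition has_strict_derivative_on ::
  "('a::abs_valued_field \<Rightarrow> 'a) \<Rightarrow> ('a \<Rightarrow> 'a) \<Rightarrow> 'a set \<Rightarrow> bool" where
  "has_strict_derivative_on f f' U \<longleftrightarrow>
     (\<forall>a\<in>U. ((\<lambda>(x, y). (f x - f y) / (x - y)) \<longlongrightarrow> f' a)
              (at (a, a) within {(x, y). x \<in> U \<and> y \<in> U \<and> x \<noteq> y}))"

end

theory Submission
  imports Defs "HOL-Number_Theory.Cong"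
begin

text \<open>
  Counting residue classes modulo \<open>p\<close> in the integers of \<open>F\<close> and of \<open>K\<close> shows that a uniformizer
  of \<open>F\<close> has absolute value \<open>1 / q\<close> and that the ball of radius \<open>absv b\<close> in \<open>K\<close> has Haar
  measure \<open>absv b ^ r\<close>. Near a zero \<open>a\<close> the ultrametric inequality makes \<open>f\<close> scale distances by
  exactly \<open>absv (f' a)\<close> and makes \<open>absv \<circ> f'\<close> constant, so for large \<open>s\<close> the condition
  \<open>absv (f x) \<le> q ^ -s\<close> cuts out near \<open>a\<close> a ball of measure \<open>(q ^ -s / absv (f' a)) ^ r\<close>, which
  contributes exactly \<open>1\<close>. By compactness \<open>f\<close> is bounded away from \<open>0\<close> elsewhere, so the sequence
  is eventually constant.
\<close>

section \<open>Subfields of the ambient field\<close>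

text \<open>The count modulo \<open>p\<close> is where degrees enter. It gives \<open>p ^ n\<close>
  classes, with \<open>n = d\<close> for \<open>F\<close> and \<open>n = d * r\<close> for
  \<open>K\<close>, while the normalisation \<open>absv p = p powr (- d)\<close> is tied to
  \<open>F\<close> alone. Hence the number of classes modulo \<open>x\<close>, times
  \<open>absv x ^ r\<close>, is \<open>1\<close> in \<open>K\<close>, and the same identity with
  exponent \<open>1\<close> holds in \<open>F\<close>; the exponent \<open>r\<close> of the formula
  comes from this. Two basic facts are not among the axioms and have to be derived: the ultrametric
  inequality, from the boundedness of the natural numbers, and the existence of a uniformizer, from
  the finiteness of the residue ring modulo \<open>p\<close>. The measure formula for balls requires
  the radius to be the absolute value of an element of \<open>K\<close>. For the radius
  \<open>q ^ -s / absv (f' a)\<close> this takes a power of a uniformizer of \<open>F\<close> and a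
  difference quotient of \<open>f\<close>.\<close>

lemma ambient_simps [simp]:
  "carrier (ambient :: 'a::abs_valued_field ring) = UNIV"
  "x \<otimes>\<^bsub>(ambient :: 'a ring)\<^esub> y = x * y"
  "x \<oplus>\<^bsub>(ambient :: 'a ring)\<^esub> y = x + y"
  "\<one>\<^bsub>(ambient :: 'a ring)\<^esub> = 1"
  "\<zero>\<^bsub>(ambient :: 'a ring)\<^esub> = 0"
  by (simp_all add: ring_of_type_algebra_def)

lemma ambient_a_inv [simp]: "\<ominus>\<^bsub>(ambient :: 'a::abs_valued_field ring)\<^esub> x = - x"
proof -
  interpret R: ring "ambient :: 'a ring" by rule
  show ?thesis by (rule R.minus_equality) auto
qed

lemma ambient_m_inv:
  assumes "x \<noteq> 0"
  shows "inv\<^bsub>(ambient :: 'a::abs_valued_field ring)\<^esub> x = inverse x"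
proof -
  interpret R: field "ambient :: 'a ring" by rule
  show ?thesis using assms by (intro R.comm_inv_char) auto
qed

context
  fixes K :: "'a::abs_valued_field set"
  assumes K: "subfield K ambient"
begin

lemma subfield_zero: "0 \<in> K"
  using subringE(2)[OF subfieldE(1)[OF K]] by simp

lemma subfield_one: "1 \<in> K"
  using subringE(3)[OF subfieldE(1)[OF K]] by simp

lemma subfield_add: "x \<in> K \<Longrightarrow> y \<in> K \<Longrightarrow> x + y \<in> K"
  using subringE(7)[OF subfieldE(1)[OF K]] by simp

lemma subfield_mult: "x \<in> K \<Longrightarrow> y \<in> K \<Longrightarrow> x * y \<in> K"
  using subringE(6)[OF subfieldE(1)[OF K]] by simp

lemma subfield_uminus: "x \<in> K \<Longrightarrow> - x \<in> K"
  using subringE(5)[OF subfieldE(1)[OF K]] by simp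

lemma subfield_diff: "x \<in> K \<Longrightarrow> y \<in> K \<Longrightarrow> x - y \<in> K"
  using subfield_add subfield_uminus by fastforce

lemma subfield_inverse: "x \<in> K \<Longrightarrow> inverse x \<in> K"
proof (cases "x = 0")
  case False
  interpret R: field "ambient :: 'a ring" by rule
  assume "x \<in> K"
  then show ?thesis
    using R.subfield_m_inv(1)[OF K, of x] False by (simp add: ambient_m_inv)
qed (simp add: subfield_zero)

lemma subfield_divide: "x \<in> K \<Longrightarrow> y \<in> K \<Longrightarrow> x / y \<in> K"
  by (simp add: divide_inverse subfield_mult subfield_inverse)

lemma subfield_power: "x \<in> K \<Longrightarrow> x ^ n \<in> K"
  by (induction n) (auto simp: subfield_one subfield_mult)

lemma subfield_of_nat: "of_nat n \<in> K"
  by (induction n) (auto simp: subfield_zero subfield_one subfield_add)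

lemma subfield_sum: "(\<And>i. i \<in> I \<Longrightarrow> g i \<in> K) \<Longrightarrow> sum g I \<in> K"
  by (induction I rule: infinite_finite_induct) (auto simp: subfield_zero subfield_add)

lemmas subfield_closed = subfield_zero subfield_one subfield_add subfield_mult subfield_uminus
  subfield_diff subfield_inverse subfield_divide subfield_power subfield_of_nat subfield_sum

end

section \<open>Linear independence and dimension in terms of indexed sums\<close>

lemma ambient_combine_eq_sum:
  assumes "length Ks = length Us"
  shows "ring.combine (ambient :: 'a::abs_valued_field ring) Ks Us = (\<Sum>i<length Us. Ks ! i * Us ! i)"
proof -
  interpret R: ring "ambient :: 'a ring" by rule
  show ?thesis
    using assms
  proof (induction Ks Us rule: list_induct2)
    case (Cons x xs y ys)
    then show ?case by (simp add: sum.lessThan_Suc_shift del: sum.lessThan_Suc)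
  qed simp
qed

context
  fixes Q K :: "'a::abs_valued_field set" and u :: "nat \<Rightarrow> 'a" and m n :: nat
  assumes Q: "subfield Q ambient"
    and dim: "ring.dimension ambient n Q K"
    and u: "\<And>i. i < m \<Longrightarrow> u i \<in> K"
    and indep: "\<And>c i. \<lbrakk>\<And>i. i < m \<Longrightarrow> c i \<in> Q; (\<Sum>i<m. c i * u i) = 0; i < m\<rbrakk> \<Longrightarrow> c i = 0"
begin

lemma independent_map: "ring.independent ambient Q (map u [0..<m])"
proof (rule ccontr)
  interpret R: ring "ambient :: 'a ring" by rule
  assume dep: "\<not> ?thesis"
  obtain Ks where Ks: "length Ks = m" "R.combine Ks (map u [0..<m]) = 0" "set Ks \<subseteq> Q" "set Ks \<noteq> {0}"
    by (rule R.dependent_imp_non_trivial_combine[OF Q _ dep]) simp_all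
  \<comment> \<open>The empty coefficient list also satisfies \<open>set Ks \<noteq> {0}\<close>, so
    the final contradiction needs a nonempty family.\<close>
  have "m \<noteq> 0"
    using dep by (cases "m = 0") auto
  have sum: "(\<Sum>i<m. Ks ! i * u i) = 0"
    using Ks(1,2) by (simp add: ambient_combine_eq_sum)
  have "Ks ! i \<in> Q" if "i < m" for i
    using Ks(1,3) that nth_mem by blast
  then have "Ks ! i = 0" if "i < m" for i
    using indep[of "(!) Ks", OF _ sum that] by blast
  then have "set Ks \<subseteq> {0}"
    using Ks(1) by (auto simp: set_conv_nth)
  with Ks(1,4) \<open>m \<noteq> 0\<close> show False
    by (metis length_0_conv set_empty subset_singletonD)
qed

lemma independent_card_le_dimension: "m \<le> n"
proof -
  interpret R: ring "ambient :: 'a ring" by rule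
  have "set (map u [0..<m]) \<subseteq> K" using u by auto
  from R.independent_length_le_dimension[OF Q dim independent_map this] show ?thesis by simp
qed

lemma basis_card_eq_dimension:
  assumes K: "subfield K ambient" and "Q \<subseteq> K"
    and span: "\<And>x. x \<in> K \<Longrightarrow> \<exists>c. (\<forall>i<m. c i \<in> Q) \<and> x = (\<Sum>i<m. c i * u i)"
  shows "m = n"
proof -
  interpret R: ring "ambient :: 'a ring" by rule
  have *: "x \<in> R.Span Q (map u [0..<m]) \<longleftrightarrow>
      (\<exists>Ks. set Ks \<subseteq> Q \<and> length Ks = m \<and> x = (\<Sum>i<m. Ks ! i * u i))" for x
    using R.Span_mem_iff_length_version[OF Q, of "map u [0..<m]" x]
    by (auto simp: ambient_combine_eq_sum)
  have "R.Span Q (map u [0..<m]) = K"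
  proof (intro equalityI subsetI)
    fix x assume "x \<in> K"
    then obtain c where "\<forall>i<m. c i \<in> Q" "x = (\<Sum>i<m. c i * u i)"
      using span by blast
    then show "x \<in> R.Span Q (map u [0..<m])"
      unfolding * by (intro exI[of _ "map c [0..<m]"]) auto
  next
    fix x assume "x \<in> R.Span Q (map u [0..<m])"
    then obtain Ks where "set Ks \<subseteq> Q" "length Ks = m" "x = (\<Sum>i<m. Ks ! i * u i)"
      unfolding * by blast
    moreover from this have "Ks ! i \<in> K" if "i < m" for i
      using that \<open>Q \<subseteq> K\<close> nth_mem by blast
    ultimately show "x \<in> K"
      using u by (auto intro!: subfield_sum[OF K] subfield_mult[OF K])
  qed
  moreover have "set (map u [0..<m]) \<subseteq> K" using u by auto
  ultimately show ?thesis
    using R.independent_length_eq_dimension[OF Q dim independent_map] by simp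
qed

end

section \<open>The absolute value\<close>

lemma absv_conv_dist: "absv x = dist x (0 :: 'a::abs_valued_field)"
  by (simp add: dist_absv)

lemma absv_nonneg [simp]: "absv (x :: 'a::abs_valued_field) \<ge> 0"
  by (simp add: absv_conv_dist)

lemma absv_eq_0_iff [simp]: "absv (x :: 'a::abs_valued_field) = 0 \<longleftrightarrow> x = 0"
  by (simp add: absv_conv_dist)

lemma absv_0 [simp]: "absv (0 :: 'a::abs_valued_field) = 0"
  by simp

lemma absv_pos_iff [simp]: "absv (x :: 'a::abs_valued_field) > 0 \<longleftrightarrow> x \<noteq> 0"
  using absv_nonneg[of x] absv_eq_0_iff[of x] by linarith

lemma absv_1 [simp]: "absv (1 :: 'a::abs_valued_field) = 1"
  using absv_mult[of "1::'a" 1] by simp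

lemma absv_minus_commute: "absv (x - y) = absv (y - x :: 'a::abs_valued_field)"
  by (metis dist_absv dist_commute)

lemma absv_uminus [simp]: "absv (- x :: 'a::abs_valued_field) = absv x"
  using absv_minus_commute[of 0 x] by simp

lemma absv_triangle: "absv (x + y :: 'a::abs_valued_field) \<le> absv x + absv y"
  using dist_triangle[of x "-y" 0] by (simp add: dist_absv)

lemma absv_power: "absv (x ^ n :: 'a::abs_valued_field) = absv x ^ n"
  by (induction n) (simp_all add: absv_mult)

lemma absv_inverse: "absv (inverse x :: 'a::abs_valued_field) = inverse (absv x)"
proof (cases "x = 0")
  case False
  then have "absv x * absv (inverse x) = 1"
    by (metis absv_1 absv_mult right_inverse)
  then show ?thesis by (metis inverse_unique)
qed simp

lemma absv_divide: "absv (x / y :: 'a::abs_valued_field) = absv x / absv y"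
  by (simp add: divide_inverse absv_mult absv_inverse)

lemma absv_sum_le: "absv (sum g I :: 'a::abs_valued_field) \<le> (\<Sum>i\<in>I. absv (g i))"
proof (induction I rule: infinite_finite_induct)
  case (insert i I)
  then show ?case using absv_triangle[of "g i" "sum g I"] by simp
qed simp_all

text \<open>Binomial coefficients have absolute value at most \<open>1\<close>, so the
  \<open>n\<close>-th power of \<open>absv (x + y)\<close> is at most \<open>n + 1\<close> times
  that of the maximum. A ratio \<open>t < 1\<close> of maximum to \<open>absv (x + y)\<close> would
  make \<open>(n + 1) * t ^ n\<close> tend to \<open>0\<close> while staying at least
  \<open>1\<close>.\<close>

lemma absv_add_le_max_if_of_nat_le_1:
  fixes x y :: "'a::abs_valued_field"
  assumes nat: "\<And>n. absv (of_nat n :: 'a) \<le> 1"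
  shows "absv (x + y) \<le> max (absv x) (absv y)"
proof (rule ccontr)
  define M where "M = max (absv x) (absv y)"
  assume "\<not> ?thesis"
  then have less: "M < absv (x + y)" by (simp add: M_def not_le)
  have M0: "M \<ge> 0" by (simp add: M_def le_max_iff_disj)
  have bound: "absv (x + y) ^ n \<le> real (Suc n) * M ^ n" for n
  proof -
    have "absv (x + y) ^ n = absv (\<Sum>k\<le>n. of_nat (n choose k) * x ^ k * y ^ (n - k))"
      by (simp only: absv_power[symmetric] binomial_ring)
    also have "\<dots> \<le> (\<Sum>k\<le>n. absv (of_nat (n choose k) * x ^ k * y ^ (n - k)))"
      by (rule absv_sum_le)
    also have "\<dots> \<le> (\<Sum>k\<le>n. M ^ n)"
    proof (rule sum_mono)
      fix k assume "k \<in> {..n}"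
      have "absv x ^ k * absv y ^ (n - k) \<le> M ^ k * M ^ (n - k)"
        by (intro mult_mono power_mono) (auto simp: M_def le_max_iff_disj)
      also have "\<dots> = M ^ n" using \<open>k \<in> {..n}\<close> by (simp flip: power_add)
      finally have "1 * (absv x ^ k * absv y ^ (n - k)) \<le> M ^ n" by simp
      moreover have "absv (of_nat (n choose k) :: 'a) * (absv x ^ k * absv y ^ (n - k))
          \<le> 1 * (absv x ^ k * absv y ^ (n - k))"
        by (intro mult_right_mono nat) auto
      ultimately show "absv (of_nat (n choose k) * x ^ k * y ^ (n - k)) \<le> M ^ n"
        by (simp add: absv_mult absv_power mult.assoc)
    qed
    also have "\<dots> = real (Suc n) * M ^ n" by simp
    finally show ?thesis .
  qed
  define t where "t = M / absv (x + y)"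
  have pos: "absv (x + y) > 0" using less M0 by linarith
  have t: "0 \<le> t" "t < 1" using less M0 pos by (auto simp: t_def)
  have "(\<lambda>n. real (Suc n) * t ^ n) \<longlonglongrightarrow> 0"
  proof -
    have "(\<lambda>n. real n * t ^ n) \<longlonglongrightarrow> 0" "(\<lambda>n. t ^ n) \<longlonglongrightarrow> 0"
      using t by (auto intro: powser_times_n_limit_0 LIMSEQ_power_zero)
    from tendsto_add[OF this] show ?thesis by (simp add: algebra_simps)
  qed
  moreover have "real (Suc n) * t ^ n \<ge> 1" for n
    using bound[of n] pos by (simp add: t_def power_divide field_simps)
  ultimately have "(1::real) \<le> 0"
    by (intro LIMSEQ_le_const) auto
  then show False by simp
qed

section \<open>The \<open>p\<close>-adic absolute value\<close>

text \<open>The number \<open>d\<close> becomes the degree of \<open>F\<close> over the p-adic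
  numbers. It is a parameter separate from any extension under study because the normalisation
  remains that of \<open>F\<close> when \<open>K\<close> is considered.\<close>

locale padic_field =
  fixes p d :: nat and Qp :: "'a::abs_valued_field set"
  assumes prime_p: "Factorial_Ring.prime p"
    and padic: "padic_numbers p Qp"
    and absv_p: "absv (of_nat p :: 'a) = real p powr (- real d)"
begin

lemma subfield_Qp: "subfield Qp ambient"
  using padic unfolding padic_numbers_def by blast

lemma prime_int_p: "Factorial_Ring.prime (int p)"
  using prime_p by simp

lemma p_gt_1: "p > 1"
  using prime_p by (rule prime_gt_1_nat)

lemma absv_of_int_if_not_dvd:
  assumes "\<not> int p dvd n"
  shows "absv (of_int n :: 'a) = 1"
proof -
  obtain c where "\<And>x. absv (of_rat x :: 'a) = padic_abs p x powr c"
    using padic by (auto simp: padic_numbers_def)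
  from this[of "of_int n"] show ?thesis
    using assms by (auto simp: padic_abs_def not_dvd_imp_multiplicity_0)
qed

lemma absv_of_int_le_1: "absv (of_int n :: 'a) \<le> 1"
proof -
  obtain c where c: "c > 0" "\<And>x. absv (of_rat x :: 'a) = padic_abs p x powr c"
    using padic by (auto simp: padic_numbers_def)
  have "padic_abs p (of_int n) \<le> 1"
    using p_gt_1 by (auto simp: padic_abs_def power_int_minus intro!: inverse_le_1_iff[THEN iffD2])
  moreover have "padic_abs p (of_int n) \<ge> 0"
    by (simp add: padic_abs_def)
  ultimately show ?thesis
    using c(2)[of "of_int n"] c(1) by (simp add: powr_le1)
qed

lemma absv_of_nat_le_1: "absv (of_nat n :: 'a) \<le> 1"
  using absv_of_int_le_1[of "int n"] by simp

lemma absv_p_pos: "absv (of_nat p :: 'a) > 0"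
  using p_gt_1 by simp

lemma absv_p_less_1: "absv (of_nat p :: 'a) < 1"
proof -
  obtain c where c: "c > 0" "\<And>x. absv (of_rat x :: 'a) = padic_abs p x powr c"
    using padic by (auto simp: padic_numbers_def)
  have "padic_abs p (of_nat p) = 1 / real p"
    using p_gt_1 prime_int_p quotient_of_int[of "int p"]
    by (simp add: padic_abs_def power_int_minus field_simps quotient_of_int)
  then have "absv (of_nat p :: 'a) = (1 / real p) powr c"
    using c(2)[of "of_nat p"] by simp
  also have "\<dots> < 1 powr c"
    using c(1) p_gt_1 by (intro powr_less_mono2) auto
  finally show ?thesis by simp
qed

lemma absv_add_le: "absv (x + y :: 'a) \<le> max (absv x) (absv y)"
  by (intro absv_add_le_max_if_of_nat_le_1 absv_of_nat_le_1)

lemma absv_diff_le: "absv (x - y :: 'a) \<le> max (absv x) (absv y)"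
  using absv_add_le[of x "-y"] by simp

lemma absv_diff_trans:
  assumes "absv (x - y :: 'a) \<le> t" "absv (y - z) \<le> t"
  shows "absv (x - z) \<le> t"
  using absv_add_le[of "x - y" "y - z"] assms by simp

text \<open>The isosceles triangle principle: the larger of two unequal values survives addition.
  Most exact equalities of absolute values below come from here.\<close>

lemma absv_eq_if_close:
  assumes "absv (x - y :: 'a) < absv y"
  shows "absv x = absv y"
proof -
  have "absv x \<le> max (absv (x - y)) (absv y)" using absv_add_le[of "x - y" y] by simp
  moreover have "absv y \<le> max (absv x) (absv (x - y))" using absv_diff_le[of x "x - y"] by simp
  ultimately show ?thesis using assms by linarith
qed

lemma absv_sum_le_const:
  assumes "t \<ge> 0" "\<And>i. i \<in> I \<Longrightarrow> absv (g i :: 'a) \<le> t"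
  shows "absv (sum g I) \<le> t"
  using assms(2)
proof (induction I rule: infinite_finite_induct)
  case (insert i I)
  then show ?case using absv_add_le[of "g i" "sum g I"] by fastforce
qed (use assms(1) in auto)

text \<open>The digits \<open>0..p-1\<close> represent the p-adic integers modulo \<open>p\<close>.
  By density \<open>a\<close> is close to a fraction \<open>m / n\<close> in lowest terms; its
  absolute value is at most \<open>1\<close>, so \<open>p\<close> does not divide \<open>n\<close>,
  and \<open>k\<close> is \<open>m\<close> times an inverse of \<open>n\<close> modulo
  \<open>p\<close>.\<close>

lemma zp_near_nat:
  assumes "a \<in> Qp" "absv a \<le> 1"
  obtains k where "k < p" "absv (a - of_nat k :: 'a) \<le> absv (of_nat p :: 'a)"
proof -
  obtain c where c: "c > 0" "\<And>x. absv (of_rat x :: 'a) = padic_abs p x powr c"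
    using padic by (auto simp: padic_numbers_def)
  have "a \<in> closure \<rat>"
    using assms(1) padic by (auto simp: padic_numbers_def)
  then obtain y :: 'a where "y \<in> \<rat>" "dist y a < absv (of_nat p :: 'a)"
    using absv_p_pos by (meson closure_approachable)
  then obtain x where x: "absv (of_rat x - a :: 'a) < absv (of_nat p :: 'a)"
    by (auto simp: dist_absv elim!: Rats_cases)
  have x1: "absv (of_rat x :: 'a) \<le> 1"
    using absv_add_le[of "of_rat x - a" a] x assms(2) absv_p_less_1 by simp
  obtain m n where mn: "quotient_of x = (m, n)" by (cases "quotient_of x")
  have n0: "n > 0" and cop: "coprime m n" and xmn: "x = of_int m / of_int n"
    using mn quotient_of_denom_pos quotient_of_coprime quotient_of_div by auto
  have ndvd: "\<not> int p dvd n"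
  proof
    assume dvd: "int p dvd n"
    then have ndvd: "\<not> int p dvd m"
      using cop prime_int_p by (meson coprime_common_divisor not_prime_unit)
    then have "x \<noteq> 0" using xmn n0 by auto
    have "multiplicity (int p) n > 0"
      using dvd n0 prime_int_p by (simp add: prime_multiplicity_gt_zero_iff)
    then have "padic_abs p x > 1"
      using \<open>x \<noteq> 0\<close> ndvd mn p_gt_1
      by (simp add: padic_abs_def not_dvd_imp_multiplicity_0 one_less_power)
    then have "padic_abs p x powr c > 1"
      using c(1) by (simp add: gr_one_powr)
    then show False using x1 c(2)[of x] by simp
  qed
  have "coprime n (int p)"
    using ndvd prime_int_p by (metis coprime_commute prime_imp_coprime)
  then obtain w where w: "[n * w = 1] (mod int p)"
    using cong_solve_coprime_int by blast
  define k where "k = nat ((w * m) mod int p)"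
  have k: "int k = (w * m) mod int p" "k < p"
    using p_gt_1 by (auto simp: k_def nat_less_iff)
  have "[n * int k = n * (w * m)] (mod int p)"
    unfolding k(1) by (simp add: cong_def mod_mult_right_eq)
  also have "[n * (w * m) = m] (mod int p)"
    using cong_scalar_right[OF w, of m] by (simp add: mult.assoc)
  finally have "int p dvd m - n * int k"
    by (metis cong_iff_dvd_diff cong_sym)
  then obtain j where j: "m - n * int k = int p * j" by blast
  have "of_rat x - of_nat k = (of_int (m - n * int k) / of_int n :: 'a)"
    using n0 by (simp add: xmn of_rat_divide field_simps)
  then have "absv (of_rat x - of_nat k :: 'a) \<le> absv (of_nat p :: 'a)"
    using absv_of_int_if_not_dvd[OF ndvd] absv_of_int_le_1[of j] 
    by (simp add: j absv_divide absv_mult mult_left_le)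
  moreover have "absv (a - of_rat x) \<le> absv (of_nat p :: 'a)"
    using x by (subst absv_minus_commute) simp
  ultimately have "absv (a - of_nat k :: 'a) \<le> absv (of_nat p :: 'a)"
    by (rule absv_diff_trans[rotated])
  with k(2) show thesis by (rule that)
qed

lemma nat_residue_unique:
  assumes "k < p" "l < p" "absv (of_nat k - of_nat l :: 'a) \<le> absv (of_nat p :: 'a)"
  shows "k = l"
proof (rule ccontr)
  assume "k \<noteq> l"
  then have "\<not> int p dvd int k - int l"
    using assms zdvd_not_zless[of "\<bar>int k - int l\<bar>" "int p"] by auto
  from absv_of_int_if_not_dvd[OF this] show False
    using assms(3) absv_p_less_1 by simp
qed

text \<open>In the p-adic numbers \<open>p\<close> itself is a uniformizer: the digit congruent to
  \<open>a\<close> cannot be \<open>0\<close>, hence is a unit. This is what permits division by a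
  coefficient that is nonzero modulo \<open>p\<close>.\<close>

lemma absv_eq_1_if_gt_p:
  assumes "a \<in> Qp" "absv a \<le> 1" "absv (of_nat p :: 'a) < absv a"
  shows "absv a = 1"
proof -
  obtain k where k: "k < p" "absv (a - of_nat k :: 'a) \<le> absv (of_nat p :: 'a)"
    using zp_near_nat assms by blast
  have "k \<noteq> 0" using k(2) assms(3) by (intro notI) simp
  then have "\<not> int p dvd int k"
    using k(1) by (auto dest: dvd_imp_le)
  from absv_of_int_if_not_dvd[OF this] have 1: "absv (of_nat k :: 'a) = 1" by simp
  then show ?thesis
    using absv_eq_if_close[of a "of_nat k"] k(2) absv_p_less_1 by simp
qed

end

section \<open>Counting residue classes\<close>

text \<open>Instantiated twice in the end, by \<open>F\<close> with \<open>n = d\<close> and by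
  \<open>K\<close> with \<open>n = d * r\<close>.\<close>

locale padic_extension = padic_field +
  fixes K :: "'a::abs_valued_field set" and n :: nat
  assumes subfield_K: "subfield K ambient"
    and Qp_subset: "Qp \<subseteq> K"
    and dimension_K: "ring.dimension ambient n Qp K"
begin

lemmas K_closed = subfield_closed[OF subfield_K]

section \<open>Residue classes of the integer ring and systems of representatives\<close>

abbreviation OK where "OK \<equiv> integer_ring K"

text \<open>For \<open>0 \<le> t \<le> 1\<close> these balls are the cosets of the ideal of elements
  of absolute value at most \<open>t\<close>, so this is its index. An infinite index would be
  recorded as \<open>0\<close>; finiteness is therefore read off from positive values.\<close>

definition residue_index :: "real \<Rightarrow> nat" where
  "residue_index t = card ((\<lambda>x. {y \<in> K. absv (y - x) \<le> t}) ` OK)"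

definition transversal :: "real \<Rightarrow> 'a set \<Rightarrow> bool" where
  "transversal t R \<longleftrightarrow> R \<subseteq> OK \<and> (\<forall>x\<in>OK. \<exists>!y. y \<in> R \<and> absv (x - y) \<le> t)"

lemma transversalD:
  assumes "transversal t R" "x \<in> OK"
  obtains y where "y \<in> R" "absv (x - y) \<le> t"
  using assms by (auto simp: transversal_def)

lemma transversal_unique:
  assumes "transversal t R" "x \<in> OK" "y \<in> R" "z \<in> R" "absv (x - y) \<le> t" "absv (x - z) \<le> t"
  shows "y = z"
  using assms by (auto simp: transversal_def)

lemma transversal_exists:
  assumes "t \<ge> 0"
  shows "\<exists>R. transversal t R"
proof -
  define c where "c x = (SOME y. y \<in> OK \<and> absv (x - y) \<le> t)" for x
  have c: "c x \<in> OK \<and> absv (x - c x) \<le> t" if "x \<in> OK" for x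
    unfolding c_def by (rule someI[of _ x]) (use that assms in auto)
  \<comment> \<open>Congruent points have the same candidates, so \<open>SOME\<close> picks the same
    representative for both.\<close>
  have c_eq: "c x = c y" if "absv (x - y) \<le> t" for x y
  proof -
    have "absv (x - z) \<le> t \<longleftrightarrow> absv (y - z) \<le> t" for z
      using absv_diff_trans[of x y t z] absv_diff_trans[of y x t z] that absv_minus_commute[of x y]
      by auto
    then show ?thesis by (simp add: c_def)
  qed
  have "transversal t (c ` OK)"
    unfolding transversal_def
  proof (intro conjI ballI)
    fix x assume x: "x \<in> OK"
    show "\<exists>!y. y \<in> c ` OK \<and> absv (x - y) \<le> t"
    proof (rule ex1I[of _ "c x"])
      show "c x \<in> c ` OK \<and> absv (x - c x) \<le> t" using c x by blast
    next
      fix y assume y: "y \<in> c ` OK \<and> absv (x - y) \<le> t"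
      then obtain z where z: "z \<in> OK" "y = c z" by blast
      then have "absv (z - y) \<le> t" using c by blast
      then have "absv (x - z) \<le> t"
        using absv_diff_trans[of x y t z] y absv_minus_commute[of z y] by simp
      then show "y = c x" using c_eq z by simp
    qed
  qed (use c in blast)
  then show ?thesis by blast
qed

lemma card_transversal:
  assumes "transversal t R" "t \<ge> 0"
  shows "card R = residue_index t"
proof -
  define B where "B = (\<lambda>x. {y \<in> K. absv (y - x) \<le> t})"
  have R: "R \<subseteq> OK" using assms by (simp add: transversal_def)
  have B_eq: "B x = B y" if "absv (x - y) \<le> t" for x y
  proof -
    have "absv (z - x) \<le> t \<longleftrightarrow> absv (z - y) \<le> t" for z
      using absv_diff_trans[of z x t y] absv_diff_trans[of z y t x] that absv_minus_commute[of x y]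
      by auto
    then show ?thesis by (simp add: B_def)
  qed
  have "inj_on B R"
  proof (rule inj_onI)
    fix x y assume xy: "x \<in> R" "y \<in> R" "B x = B y"
    have "x \<in> K" using xy(1) R by (auto simp: integer_ring_def)
    then have "x \<in> B x" using assms(2) by (simp add: B_def)
    then have "absv (x - y) \<le> t" unfolding xy(3) by (simp add: B_def)
    then show "x = y"
      using transversal_unique[OF assms(1), of x x y] xy(1,2) R assms(2) by auto
  qed
  moreover have "B ` OK = B ` R"
  proof (intro equalityI subsetI)
    fix V assume "V \<in> B ` OK"
    then obtain x where x: "x \<in> OK" "V = B x" by blast
    obtain y where y: "y \<in> R" "absv (x - y) \<le> t"
      by (rule transversalD[OF assms(1) x(1)])
    show "V \<in> B ` R" unfolding x(2) B_eq[OF y(2)] using y(1) by (rule imageI)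
  qed (use R in auto)
  ultimately show ?thesis
    unfolding residue_index_def B_def[symmetric] by (simp add: card_image)
qed

lemma OK_mult: "x \<in> OK \<Longrightarrow> y \<in> OK \<Longrightarrow> x * y \<in> OK"
  using K_closed by (auto simp: integer_ring_def absv_mult mult_le_one)

lemma OK_add: "x \<in> OK \<Longrightarrow> y \<in> OK \<Longrightarrow> x + y \<in> OK"
  using K_closed(3) absv_add_le[of x y] by (auto simp: integer_ring_def)

lemma OK_divide: "x \<in> K \<Longrightarrow> a \<in> K \<Longrightarrow> a \<noteq> 0 \<Longrightarrow> absv x \<le> absv a \<Longrightarrow> x / a \<in> OK"
  using K_closed(8) by (auto simp: integer_ring_def absv_divide)

text \<open>Expansion in two digits: \<open>r\<close> represents \<open>x\<close> modulo
  \<open>a\<close>, and \<open>s\<close> represents \<open>(x - r) / a\<close> at scale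
  \<open>t\<close>, so the sums \<open>r + a * s\<close> represent \<open>x\<close> at scale
  \<open>absv a * t\<close>. Uniqueness goes in the same order, since closeness at the fine scale
  determines \<open>r\<close> first.\<close>

lemma residue_index_mult:
  assumes a: "a \<in> OK" "a \<noteq> 0" and t: "0 \<le> t" "t \<le> 1"
  shows "residue_index (absv a * t) = residue_index (absv a) * residue_index t"
proof -
  obtain R S where R: "transversal (absv a) R" and S: "transversal t S"
    using transversal_exists t by (meson absv_nonneg)
  define g where "g = (\<lambda>(r, s). r + a * s)"
  have RO: "R \<subseteq> OK" and SO: "S \<subseteq> OK"
    using R S by (auto simp: transversal_def)
  have scale: "absv ((x - r) / a - s) = absv (x - g (r, s)) / absv a" for x r s
  proof -
    have "(x - r) / a - s = (x - g (r, s)) / a"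
      using a by (simp add: g_def field_simps)
    then show ?thesis by (simp add: absv_divide)
  qed
  have close: "absv (x - r) \<le> absv a"
    if "s \<in> S" "absv (x - g (r, s)) \<le> absv a * t" for x r s
  proof -
    have "absv (x - g (r, s)) \<le> absv a"
      using that(2) t mult_left_le[of t "absv a"] by simp
    moreover have "absv (g (r, s) - r) \<le> absv a"
      using that(1) SO by (auto simp: g_def absv_mult integer_ring_def intro!: mult_left_le)
    ultimately show ?thesis by (rule absv_diff_trans)
  qed
  have uniq: "(r, s) = (r', s')"
    if x: "x \<in> OK" and m: "r \<in> R" "s \<in> S" "r' \<in> R" "s' \<in> S"
      and d: "absv (x - g (r, s)) \<le> absv a * t" "absv (x - g (r', s')) \<le> absv a * t"
    for x r s r' s'
  proof -
    have rr: "r = r'"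
      using transversal_unique[OF R x m(1,3)] close[OF m(2) d(1)] close[OF m(4) d(2)] .
    have "(x - r) / a \<in> OK"
      using x a m(1) RO close[OF m(2) d(1)] K_closed(6)
      by (intro OK_divide) (auto simp: integer_ring_def)
    moreover have "absv ((x - r) / a - s) \<le> t" "absv ((x - r) / a - s') \<le> t"
      using d a unfolding scale rr by (simp_all add: field_simps)
    ultimately have "s = s'"
      using transversal_unique[OF S _ m(2,4)] by blast
    with rr show ?thesis by simp
  qed
  have gO: "g (r, s) \<in> OK" if "r \<in> R" "s \<in> S" for r s
    using that RO SO a unfolding g_def by (auto intro!: OK_add OK_mult)
  have "transversal (absv a * t) (g ` (R \<times> S))"
    unfolding transversal_def
  proof (intro conjI ballI)
    fix x assume x: "x \<in> OK"
    obtain r where r: "r \<in> R" "absv (x - r) \<le> absv a" using transversalD[OF R x] by blast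
    then have "(x - r) / a \<in> OK"
      using x a RO K_closed(6) by (intro OK_divide) (auto simp: integer_ring_def)
    then obtain s where s: "s \<in> S" "absv ((x - r) / a - s) \<le> t" using transversalD[OF S] by blast
    have xg: "absv (x - g (r, s)) \<le> absv a * t"
      using s(2) a unfolding scale by (simp add: field_simps)
    show "\<exists>!y. y \<in> g ` (R \<times> S) \<and> absv (x - y) \<le> absv a * t"
    proof (rule ex1I[of _ "g (r, s)"])
      fix y assume y: "y \<in> g ` (R \<times> S) \<and> absv (x - y) \<le> absv a * t"
      then obtain r' s' where "y = g (r', s')" "r' \<in> R" "s' \<in> S" by auto
      then show "y = g (r, s)"
        using uniq[OF x r(1) s(1) _ _ xg, of r' s'] y by auto
    qed (use r(1) s(1) xg in simp)
  qed (use gO in auto)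
  moreover have "inj_on g (R \<times> S)"
  proof (rule inj_onI; clarify)
    fix r s r' s' assume m: "r \<in> R" "s \<in> S" "r' \<in> R" "s' \<in> S" and eq: "g (r, s) = g (r', s')"
    show "r = r' \<and> s = s'"
      using uniq[OF gO[OF m(1,2)] m] eq t by simp
  qed
  ultimately show ?thesis
    using card_transversal[OF R] card_transversal[OF S t(1)] t
    by (simp add: card_transversal[symmetric] card_image card_cartesian_product)
qed

text \<open>A maximal family that is independent modulo \<open>p\<close> is a basis of \<open>K\<close> over the \<open>p\<close>-adic numbers:
  rescaling a relation gives independence, and successive approximation together with completeness
  shows that it spans. Hence the residue ring modulo \<open>p\<close> has \<open>p ^ n\<close> elements.\<close>

definition independent_mod_p :: "nat \<Rightarrow> (nat \<Rightarrow> 'a) \<Rightarrow> bool" where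
  "independent_mod_p m u \<longleftrightarrow> (\<forall>i<m. u i \<in> OK) \<and>
     (\<forall>c. (\<forall>i<m. c i \<in> Qp \<and> absv (c i) \<le> 1) \<and>
          absv (\<Sum>i<m. c i * u i) \<le> absv (of_nat p :: 'a) \<longrightarrow>
          (\<forall>i<m. absv (c i) \<le> absv (of_nat p :: 'a)))"

lemma independent_mod_pD:
  assumes "independent_mod_p m u" "\<forall>i<m. c i \<in> Qp \<and> absv (c i) \<le> 1"
    "absv (\<Sum>i<m. c i * u i) \<le> absv (of_nat p :: 'a)" "i < m"
  shows "absv (c i) \<le> absv (of_nat p :: 'a)"
  using assms unfolding independent_mod_p_def by blast

lemma independent_mod_p_imp_independent:
  assumes u: "independent_mod_p m u" and c: "\<And>i. i < m \<Longrightarrow> c i \<in> Qp"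
    and sum: "(\<Sum>i<m. c i * u i) = 0" and i: "i < m"
  shows "c i = 0"
proof (rule ccontr)
  assume "c i \<noteq> 0"
  \<comment> \<open>Dividing the relation by its largest coefficient keeps all coefficients integral
    and turns the \<open>j\<close>-th into \<open>1\<close>, which is nonzero modulo
    \<open>p\<close>.\<close>
  obtain j where j: "j < m" "\<And>k. k < m \<Longrightarrow> absv (c k) \<le> absv (c j)"
    using obtains_MAX[of "{..<m}" "\<lambda>k. absv (c k)"] i
    by (metis Max_ge empty_iff finite_imageI finite_lessThan image_eqI lessThan_iff)
  have cj: "absv (c j) > 0"
    using j(2)[OF i] \<open>c i \<noteq> 0\<close> by (metis absv_pos_iff order_less_le_trans)
  have "(\<Sum>i<m. c i / c j * u i) = (\<Sum>i<m. c i * u i) / c j"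
    by (simp add: sum_divide_distrib)
  then have "absv (\<Sum>i<m. c i / c j * u i) \<le> absv (of_nat p :: 'a)"
    using sum by simp
  moreover have "\<forall>i<m. c i / c j \<in> Qp \<and> absv (c i / c j) \<le> 1"
    using c j cj subfield_divide[OF subfield_Qp] by (auto simp: absv_divide)
  ultimately have "absv (c j / c j) \<le> absv (of_nat p :: 'a)"
    using independent_mod_pD[OF u, of "\<lambda>i. c i / c j" j] j(1) by simp
  then show False using cj absv_p_less_1 by simp
qed

lemma independent_mod_p_card_le:
  assumes "independent_mod_p m u"
  shows "m \<le> n"
proof (rule independent_card_le_dimension[OF subfield_Qp dimension_K])
  show "u i \<in> K" if "i < m" for i
    using assms that by (auto simp: independent_mod_p_def integer_ring_def)
qed (rule independent_mod_p_imp_independent[OF assms])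

text \<open>Adjoining \<open>x\<close> to the family creates a relation modulo \<open>p\<close>. Its
  coefficient at \<open>x\<close> cannot vanish modulo \<open>p\<close>, by independence of
  \<open>u\<close>, so it is a unit and the relation can be solved for \<open>x\<close>.\<close>

lemma maximal_independent_mod_p_spans:
  assumes u: "independent_mod_p m u" and max: "\<And>v. \<not> independent_mod_p (Suc m) v"
    and x: "x \<in> OK"
  shows "\<exists>c. (\<forall>i<m. c i \<in> Qp \<and> absv (c i) \<le> 1) \<and>
    absv (x - (\<Sum>i<m. c i * u i)) \<le> absv (of_nat p :: 'a)"
proof -
  have uO: "u i \<in> OK" if "i < m" for i
    using u that by (auto simp: independent_mod_p_def)
  define v where "v = u(m := x)"
  have "\<forall>i<Suc m. v i \<in> OK"
    using uO x by (auto simp: v_def less_Suc_eq)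
  then obtain c where c: "\<forall>i<Suc m. c i \<in> Qp \<and> absv (c i) \<le> 1"
    and small: "absv (\<Sum>i<Suc m. c i * v i) \<le> absv (of_nat p :: 'a)"
    and big: "\<not> (\<forall>i<Suc m. absv (c i) \<le> absv (of_nat p :: 'a))"
    using max[of v] unfolding independent_mod_p_def by blast
  define s where "s = (\<Sum>i<m. c i * u i)"
  have sv: "(\<Sum>i<Suc m. c i * v i) = s + c m * x"
    by (simp add: v_def s_def)
  have "absv (c m) > absv (of_nat p :: 'a)"
  proof (rule ccontr)
    assume "\<not> ?thesis"
    then have cm: "absv (c m) \<le> absv (of_nat p :: 'a)" by simp
    moreover have "absv (c m * x) \<le> absv (c m)"
      using x by (simp add: absv_mult integer_ring_def mult_left_le)
    ultimately have "absv s \<le> absv (of_nat p :: 'a)"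
      using absv_diff_le[of "s + c m * x" "c m * x"] small unfolding sv by simp
    then have "\<forall>i<m. absv (c i) \<le> absv (of_nat p :: 'a)"
      using u c unfolding independent_mod_p_def s_def by (meson less_Suc_eq)
    with cm big show False by (auto simp: less_Suc_eq)
  qed
  then have cm: "absv (c m) = 1"
    using c absv_eq_1_if_gt_p by blast
  then have cm0: "c m \<noteq> 0" by auto
  define e where "e i = - c i / c m" for i
  have "x - (\<Sum>i<m. e i * u i) = x + s / c m"
    by (simp add: e_def s_def sum_divide_distrib sum_negf)
  also have "\<dots> = (s + c m * x) / c m"
    using cm0 by (simp add: field_simps)
  finally have "absv (x - (\<Sum>i<m. e i * u i)) \<le> absv (of_nat p :: 'a)"
    using small cm unfolding sv by (simp add: absv_divide)
  moreover have "\<forall>i<m. e i \<in> Qp \<and> absv (e i) \<le> 1"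
    using c cm subfield_closed(5,8)[OF subfield_Qp] by (auto simp: e_def absv_divide)
  ultimately show ?thesis by blast
qed

text \<open>The representatives are the combinations of \<open>u\<close> with digits in
  \<open>0..p-1\<close>: spanning reaches every class, and independence separates the digit vectors.
  \<open>PiE\<close> makes these vectors extensional, so that there are exactly \<open>p ^ m\<close>
  of them.\<close>

lemma independent_mod_p_transversal:
  assumes u: "independent_mod_p m u" and max: "\<And>v. \<not> independent_mod_p (Suc m) v"
  shows "residue_index (absv (of_nat p :: 'a)) = p ^ m"
proof -
  define A where "A = PiE {..<m} (\<lambda>_. {..<p})"
  define g where "g k = (\<Sum>i<m. of_nat (k i) * u i)" for k :: "nat \<Rightarrow> nat"
  have uO: "u i \<in> OK" if "i < m" for i
    using u that by (auto simp: independent_mod_p_def)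
  have eq: "k = l" if k: "k \<in> A" and l: "l \<in> A" and kl: "absv (g k - g l) \<le> absv (of_nat p :: 'a)" for k l
  proof (rule PiE_ext[OF k[unfolded A_def] l[unfolded A_def]])
    fix i assume "i \<in> {..<m}"
    then have i: "i < m" "k i < p" "l i < p" using k l by (auto simp: A_def)
    have "g k - g l = (\<Sum>i<m. (of_nat (k i) - of_nat (l i)) * u i)"
      by (simp add: g_def sum_subtractf left_diff_distrib)
    moreover have "\<forall>i<m. (of_nat (k i) - of_nat (l i) :: 'a) \<in> Qp \<and> absv (of_nat (k i) - of_nat (l i) :: 'a) \<le> 1"
      using absv_diff_le absv_of_nat_le_1 subfield_closed(6,10)[OF subfield_Qp]
      by (meson le_max_iff_disj max.bounded_iff order_trans)
    ultimately have "absv (of_nat (k i) - of_nat (l i) :: 'a) \<le> absv (of_nat p :: 'a)"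
      using independent_mod_pD[OF u, of "\<lambda>i. of_nat (k i) - of_nat (l i)" i] kl i by simp
    then show "k i = l i" using nat_residue_unique i by blast
  qed
  have gO: "g k \<in> OK" for k
    using absv_of_nat_le_1 uO unfolding g_def
    by (auto simp: integer_ring_def absv_mult intro!: absv_sum_le_const mult_le_one K_closed(4,10,11))
  have "transversal (absv (of_nat p :: 'a)) (g ` A)"
    unfolding transversal_def
  proof (intro conjI ballI)
    fix x assume x: "x \<in> OK"
    obtain c where c: "\<forall>i<m. c i \<in> Qp \<and> absv (c i) \<le> 1"
      and xc: "absv (x - (\<Sum>i<m. c i * u i)) \<le> absv (of_nat p :: 'a)"
      using maximal_independent_mod_p_spans[OF u max x] by blast
    have "\<exists>k. i < m \<longrightarrow> k < p \<and> absv (c i - of_nat k) \<le> absv (of_nat p :: 'a)" for i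
      using c zp_near_nat by metis
    then obtain k where k: "\<And>i. i < m \<Longrightarrow> k i < p \<and> absv (c i - of_nat (k i)) \<le> absv (of_nat p :: 'a)"
      by metis
    define l where "l = restrict k {..<m}"
    have l: "l \<in> A" using k by (auto simp: l_def A_def)
    have "(\<Sum>i<m. c i * u i) - g l = (\<Sum>i<m. (c i - of_nat (k i)) * u i)"
      by (simp add: g_def l_def sum_subtractf left_diff_distrib)
    moreover have "absv ((c i - of_nat (k i)) * u i) \<le> absv (of_nat p :: 'a)" if "i < m" for i
    proof -
      have "absv (c i - of_nat (k i)) * absv (u i) \<le> absv (of_nat p :: 'a) * 1"
        using k[OF that] uO[OF that] by (intro mult_mono) (auto simp: integer_ring_def)
      then show ?thesis by (simp add: absv_mult)
    qed
    ultimately have "absv ((\<Sum>i<m. c i * u i) - g l) \<le> absv (of_nat p :: 'a)"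
      by (auto intro!: absv_sum_le_const)
    with xc have xl: "absv (x - g l) \<le> absv (of_nat p :: 'a)"
      by (rule absv_diff_trans)
    show "\<exists>!y. y \<in> g ` A \<and> absv (x - y) \<le> absv (of_nat p :: 'a)"
    proof (rule ex1I[of _ "g l"])
      fix y assume y: "y \<in> g ` A \<and> absv (x - y) \<le> absv (of_nat p :: 'a)"
      then obtain k where k: "y = g k" "k \<in> A" by blast
      have "absv (y - g l) \<le> absv (of_nat p :: 'a)"
        using absv_diff_trans[of y x _ "g l"] y xl absv_minus_commute[of x y] by simp
      then show "y = g l" using eq[OF k(2) l] k(1) by simp
    qed (use l xl in simp)
  qed (use gO in auto)
  then have "residue_index (absv (of_nat p :: 'a)) = card (g ` A)"
    by (simp add: card_transversal)
  also have "\<dots> = card A"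
    by (intro card_image inj_onI eq) auto
  also have "\<dots> = p ^ m"
    by (simp add: A_def card_PiE)
  finally show ?thesis .
qed

lemma maximal_independent_mod_p_spans_OK:
  assumes u: "independent_mod_p m u" and max: "\<And>v. \<not> independent_mod_p (Suc m) v"
    and x: "x \<in> OK"
  shows "\<exists>c. (\<forall>i<m. c i \<in> Qp) \<and> x = (\<Sum>i<m. c i * u i)"
proof -
  let ?p = "of_nat p :: 'a"
  have p0: "?p \<noteq> 0" using absv_p_pos by (metis absv_pos_iff)
  have uO: "u i \<in> OK" if "i < m" for i
    using u that by (auto simp: independent_mod_p_def)
  define C where "C y = (SOME c. (\<forall>i<m. c i \<in> Qp \<and> absv (c i) \<le> 1) \<and>
    absv (y - (\<Sum>i<m. c i * u i)) \<le> absv ?p)" for y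
  have C: "\<forall>i<m. C y i \<in> Qp \<and> absv (C y i) \<le> 1" "absv (y - (\<Sum>i<m. C y i * u i)) \<le> absv ?p"
    if "y \<in> OK" for y
    using someI_ex[OF maximal_independent_mod_p_spans[OF u max that]] unfolding C_def by auto
  \<comment> \<open>\<open>V (Suc k)\<close> is the error in approximating \<open>V k\<close> modulo
    \<open>p\<close>, divided by \<open>p\<close>, hence again integral. With \<open>S k i\<close>
    as partial sums of the p-adic expansion of the \<open>i\<close>-th coefficient, the error after
    \<open>k\<close> rounds is exactly \<open>p ^ k * V k\<close>.\<close>
  define V where "V = rec_nat x (\<lambda>_ y. (y - (\<Sum>i<m. C y i * u i)) / ?p)"
  have V_Suc: "V (Suc k) = (V k - (\<Sum>i<m. C (V k) i * u i)) / ?p" for k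
    by (simp add: V_def)
  have VO: "V k \<in> OK" for k
  proof (induction k)
    case (Suc k)
    have "V k - (\<Sum>i<m. C (V k) i * u i) \<in> K"
      using Suc C(1)[OF Suc] uO Qp_subset
      by (auto simp: integer_ring_def intro!: K_closed(3,4,6,11))
    then show ?case
      using C(2)[OF Suc] p0 unfolding V_Suc by (intro OK_divide K_closed(10))
  qed (simp add: V_def x)
  define S where "S k i = (\<Sum>j<k. ?p ^ j * C (V j) i)" for k i
  have S_Qp: "S k i \<in> Qp" if "i < m" for k i
    using C(1)[OF VO] that unfolding S_def by (intro subfield_closed[OF subfield_Qp]) auto
  have remainder: "x - (\<Sum>i<m. S k i * u i) = ?p ^ k * V k" for k
  proof (induction k)
    case (Suc k)
    have "(\<Sum>i<m. S (Suc k) i * u i) = (\<Sum>i<m. S k i * u i) + ?p ^ k * (\<Sum>i<m. C (V k) i * u i)"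
      by (simp add: S_def algebra_simps sum.distrib sum_distrib_left)
    then have "x - (\<Sum>i<m. S (Suc k) i * u i) = ?p ^ k * (V k - (\<Sum>i<m. C (V k) i * u i))"
      using Suc by (simp add: algebra_simps)
    also have "\<dots> = ?p ^ Suc k * V (Suc k)"
      using p0 by (simp add: V_Suc)
    finally show ?case .
  qed (simp add: S_def V_def)
  \<comment> \<open>By the ultrametric inequality a block of the series is bounded by its first
    term, which gives both the Cauchy property and the rate of convergence.\<close>
  have S_diff: "absv (S (k + l) i - S k i) \<le> absv ?p ^ k" if i: "i < m" for k l i
  proof -
    have "S (k + l) i - S k i = (\<Sum>j\<in>{k..<k + l}. ?p ^ j * C (V j) i)"
      unfolding S_def by (simp add: lessThan_atLeast0 sum_diff_nat_ivl)
    also have "absv \<dots> \<le> absv ?p ^ k"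
    proof (rule absv_sum_le_const)
      fix j assume j: "j \<in> {k..<k + l}"
      have "absv ?p ^ j * absv (C (V j) i) \<le> absv ?p ^ k * 1"
        using C(1)[OF VO] i j absv_p_less_1
        by (intro mult_mono power_decreasing) auto
      then show "absv (?p ^ j * C (V j) i) \<le> absv ?p ^ k"
        by (simp add: absv_mult absv_power)
    qed simp
    finally show ?thesis .
  qed
  have p_power_small: "\<exists>k. absv ?p ^ k < e" if "e > 0" for e
    using real_arch_pow_inv[OF that absv_p_less_1] .
  have "\<exists>L. L \<in> Qp \<and> (\<forall>k. absv (S k i - L) \<le> absv ?p ^ k)" if i: "i < m" for i
  proof -
    have "Cauchy (\<lambda>k. S k i)"
      unfolding Cauchy_altdef2
    proof (intro allI impI)
      fix e :: real assume "e > 0"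
      then obtain k where k: "absv ?p ^ k < e" using p_power_small by blast
      have "dist (S j i) (S k i) < e" if "j \<ge> k" for j
        using S_diff[OF i, of k "j - k"] k that by (simp add: dist_absv)
      then show "\<exists>N. \<forall>n\<ge>N. dist (S n i) (S N i) < e" by blast
    qed
    moreover have "complete Qp" using padic unfolding padic_numbers_def by blast
    ultimately obtain L where L: "L \<in> Qp" "(\<lambda>k. S k i) \<longlonglongrightarrow> L"
      using S_Qp[OF i] by (elim completeE[where f = "\<lambda>k. S k i"]) auto
    have "absv (S k i - L) \<le> absv ?p ^ k" for k
    proof -
      have "\<forall>\<^sub>F j in sequentially. dist (S j i) L < absv ?p ^ k"
        using L(2) p0 by (intro tendstoD) auto
      then obtain N where N: "\<And>j. j \<ge> N \<Longrightarrow> dist (S j i) L < absv ?p ^ k"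
        by (auto simp: eventually_sequentially)
      have "absv (S k i - S (k + N) i) \<le> absv ?p ^ k"
        using S_diff[OF i, of k N] by (simp add: absv_minus_commute)
      moreover have "absv (S (k + N) i - L) \<le> absv ?p ^ k"
        using N[of "k + N"] by (simp add: dist_absv)
      ultimately show ?thesis by (rule absv_diff_trans)
    qed
    with L(1) show ?thesis by blast
  qed
  then have "\<exists>L. \<forall>i. i < m \<longrightarrow> L i \<in> Qp \<and> (\<forall>k. absv (S k i - L i) \<le> absv ?p ^ k)"
    by (intro choice) blast
  then obtain L where L: "\<And>i. i < m \<Longrightarrow> L i \<in> Qp" "\<And>i k. i < m \<Longrightarrow> absv (S k i - L i) \<le> absv ?p ^ k"
    by blast
  have "absv (x - (\<Sum>i<m. L i * u i)) \<le> absv ?p ^ k" for k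
  proof (rule absv_diff_trans)
    show "absv (x - (\<Sum>i<m. S k i * u i)) \<le> absv ?p ^ k"
      unfolding remainder using VO[of k] by (simp add: absv_mult absv_power integer_ring_def mult_left_le)
    have "(\<Sum>i<m. S k i * u i) - (\<Sum>i<m. L i * u i) = (\<Sum>i<m. (S k i - L i) * u i)"
      by (simp add: sum_subtractf left_diff_distrib)
    also have "absv \<dots> \<le> absv ?p ^ k"
    proof (rule absv_sum_le_const)
      fix i assume "i \<in> {..<m}"
      then have "absv (S k i - L i) * absv (u i) \<le> absv ?p ^ k * 1"
        using L(2) uO by (intro mult_mono) (auto simp: integer_ring_def)
      then show "absv ((S k i - L i) * u i) \<le> absv ?p ^ k"
        by (simp add: absv_mult)
    qed simp
    finally show "absv ((\<Sum>i<m. S k i * u i) - (\<Sum>i<m. L i * u i)) \<le> absv ?p ^ k" .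
  qed
  then have "\<not> absv (x - (\<Sum>i<m. L i * u i)) > 0"
    using p_power_small by (meson not_le)
  then have "x = (\<Sum>i<m. L i * u i)"
    by simp
  with L(1) show ?thesis by blast
qed

text \<open>Independent families have length at most \<open>n\<close> and the empty one exists, so
  there is a longest one. It spans \<open>K\<close> and not only \<open>OK\<close>, because a power
  of \<open>p\<close> moves any element of \<open>K\<close> into \<open>OK\<close>; hence its length
  is \<open>n\<close>.\<close>

lemma residue_index_p: "residue_index (absv (of_nat p :: 'a)) = p ^ n"
proof -
  have "independent_mod_p 0 u" for u by (simp add: independent_mod_p_def)
  then have "\<exists>m. (\<exists>u. independent_mod_p m u) \<and> (\<forall>k. (\<exists>u. independent_mod_p k u) \<longrightarrow> k \<le> m)"
    using independent_mod_p_card_le by (intro Nat.ex_has_greatest_nat[of _ 0 n]) blast+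
  then obtain m u where u: "independent_mod_p m u"
    and "\<forall>k. (\<exists>u. independent_mod_p k u) \<longrightarrow> k \<le> m"
    by blast
  then have max: "\<not> independent_mod_p (Suc m) v" for v
    using Suc_n_not_le_n by blast
  have "m = n"
  proof (rule basis_card_eq_dimension[OF subfield_Qp dimension_K])
    fix x assume x: "x \<in> K"
    \<comment> \<open>The summand \<open>1\<close> in the denominator covers
      \<open>x = 0\<close>.\<close>
    have "\<exists>k. absv (of_nat p :: 'a) ^ k < 1 / (absv x + 1)"
      using absv_p_less_1 by (intro real_arch_pow_inv) (auto intro: add_nonneg_pos)
    then obtain k where "absv (of_nat p :: 'a) ^ k < 1 / (absv x + 1)" by blast
    moreover have "absv x + 1 > 0" by (simp add: add_nonneg_pos)
    ultimately have "absv (of_nat p :: 'a) ^ k * (absv x + 1) < 1"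
      by (simp add: field_simps)
    moreover have "absv (of_nat p :: 'a) ^ k \<ge> 0" by simp
    ultimately have "absv (of_nat p :: 'a) ^ k * absv x \<le> 1"
      unfolding distrib_left by linarith
    then have "of_nat p ^ k * x \<in> OK"
      using x K_closed by (simp add: integer_ring_def absv_mult absv_power)
    then obtain c where c: "\<forall>i<m. c i \<in> Qp" "of_nat p ^ k * x = (\<Sum>i<m. c i * u i)"
      using maximal_independent_mod_p_spans_OK[OF u max] by blast
    have "x = (\<Sum>i<m. c i / of_nat p ^ k * u i)"
      using c(2) p_gt_1 by (simp add: field_simps flip: sum_divide_distrib)
    moreover have "\<forall>i<m. c i / of_nat p ^ k \<in> Qp"
      using c(1) subfield_closed[OF subfield_Qp] by auto
    ultimately show "\<exists>c. (\<forall>i<m. c i \<in> Qp) \<and> x = (\<Sum>i<m. c i * u i)" 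
      by (intro exI[of _ "\<lambda>i. c i / of_nat p ^ k"]) simp
  next
    show "u i \<in> K" if "i < m" for i
      using u that by (auto simp: independent_mod_p_def integer_ring_def)
  qed (use independent_mod_p_imp_independent[OF u] subfield_K Qp_subset in blast)+
  then show ?thesis using independent_mod_p_transversal[OF u max] by simp
qed

section \<open>Uniformizers and the value group\<close>

definition uniformizer :: "'a \<Rightarrow> bool" where
  "uniformizer \<pi> \<longleftrightarrow>
     \<pi> \<in> K \<and> \<pi> \<noteq> 0 \<and> absv \<pi> < 1 \<and> (\<forall>x\<in>K. absv x < 1 \<longrightarrow> absv x \<le> absv \<pi>)"

text \<open>A value above \<open>absv p\<close> depends only on the class modulo \<open>p\<close>,
  and there are finitely many classes. The maximum over nonzero representatives of value below
  \<open>1\<close>, with \<open>p\<close> added to account for all smaller values, is therefore the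
  largest value below \<open>1\<close>.\<close>

lemma uniformizer_exists: "\<exists>\<pi>. uniformizer \<pi>"
proof -
  let ?p = "of_nat p :: 'a"
  obtain R where R: "transversal (absv ?p) R"
    using transversal_exists by (meson absv_nonneg)
  have "card R = p ^ n"
    using card_transversal[OF R] residue_index_p by simp
  then have "finite R"
    using p_gt_1 by (intro card_ge_0_finite) simp
  define W where "W = insert ?p {y \<in> R. absv y < 1 \<and> y \<noteq> 0}"
  have fin: "finite W" "W \<noteq> {}" using \<open>finite R\<close> by (auto simp: W_def)
  obtain \<pi> where \<pi>: "\<pi> \<in> W" "\<And>y. y \<in> W \<Longrightarrow> absv y \<le> absv \<pi>"
    using obtains_MAX[OF fin, of absv] fin
    by (metis Max_ge finite_imageI image_eqI)
  have "uniformizer \<pi>"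
    unfolding uniformizer_def
  proof (intro conjI ballI impI)
    have "R \<subseteq> K" using R by (auto simp: transversal_def integer_ring_def)
    then show "\<pi> \<in> K" "\<pi> \<noteq> 0" "absv \<pi> < 1"
      using \<pi>(1) absv_p_pos absv_p_less_1 K_closed(10) by (auto simp: W_def)
    fix x assume x: "x \<in> K" "absv x < 1"
    show "absv x \<le> absv \<pi>"
    proof (cases "absv x \<le> absv ?p")
      case True
      then show ?thesis using \<pi>(2)[of ?p] by (simp add: W_def)
    next
      case False
      have "x \<in> OK" using x by (simp add: integer_ring_def)
      then obtain y where y: "y \<in> R" "absv (x - y) \<le> absv ?p" by (rule transversalD[OF R])
      have eq: "absv y = absv x"
        using absv_eq_if_close[of y x] y(2) False absv_minus_commute[of x y] by simp
      then have "y \<in> W" using x(2) y(1) False by (auto simp: W_def)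
      then show ?thesis using \<pi>(2) eq by metis
    qed
  qed
  then show ?thesis ..
qed

context
  fixes \<pi> :: 'a
  assumes unif: "uniformizer \<pi>"
begin

lemma uniformizerD:
  shows "\<pi> \<in> K" "\<pi> \<noteq> 0" "absv \<pi> < 1" "\<And>x. x \<in> K \<Longrightarrow> absv x < 1 \<Longrightarrow> absv x \<le> absv \<pi>"
  using unif by (auto simp: uniformizer_def)

text \<open>Dividing \<open>x\<close> by the last power of the uniformizer whose value is not below
  \<open>absv x\<close> leaves a value in the half-open interval from \<open>absv \<pi>\<close>
  (excluded) to \<open>1\<close>, and \<open>1\<close> is the only one there.\<close>

lemma absv_eq_uniformizer_power:
  assumes x: "x \<in> OK" "x \<noteq> 0"
  shows "\<exists>k. absv x = absv \<pi> ^ k"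
proof -
  obtain N where N: "absv \<pi> ^ N < absv x"
    using real_arch_pow_inv[of "absv x" "absv \<pi>"] x uniformizerD by auto
  define j where "j = (LEAST j. absv \<pi> ^ j < absv x)"
  have j: "absv \<pi> ^ j < absv x" unfolding j_def using N by (rule LeastI)
  have "j \<noteq> 0" using j x by (intro notI) (simp add: integer_ring_def)
  then obtain k where k: "j = Suc k" by (cases j) auto
  then have "\<not> absv \<pi> ^ k < absv x"
    using not_less_Least[of k "\<lambda>j. absv \<pi> ^ j < absv x"] by (simp add: j_def)
  then have le: "absv x \<le> absv \<pi> ^ k" by simp
  define y where "y = x / \<pi> ^ k"
  have y: "y \<in> K" using x uniformizerD(1) K_closed by (simp add: y_def integer_ring_def)
  have yv: "absv y = absv x / absv \<pi> ^ k" by (simp add: y_def absv_divide absv_power)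
  have "absv \<pi> < absv y"
    using j uniformizerD(2) by (simp add: yv k field_simps)
  then have "\<not> absv y < 1" using uniformizerD(4)[OF y] by linarith
  moreover have "absv y \<le> 1" using le uniformizerD(2) by (simp add: yv)
  ultimately have "absv x = absv \<pi> ^ k" using uniformizerD(2) by (simp add: yv)
  then show ?thesis by blast
qed

lemma residue_index_uniformizer_power: "residue_index (absv \<pi> ^ k) = residue_index (absv \<pi>) ^ k"
proof (induction k)
  case 0
  have "transversal 1 {0}"
    using K_closed(1) by (auto simp: transversal_def integer_ring_def)
  from card_transversal[OF this] show ?case by simp
next
  case (Suc k)
  then show ?case
    using residue_index_mult[of \<pi> "absv \<pi> ^ k"] uniformizerD by (simp add: integer_ring_def power_le_one)
qed

text \<open>No value lies strictly between \<open>absv \<pi>\<close> and \<open>1\<close>, so the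
  cosets of the maximal ideal are the closed balls of radius \<open>absv \<pi>\<close>.\<close>

lemma card_residue_field: "card (carrier (residue_field K)) = residue_index (absv \<pi>)"
proof -
  have coset: "(\<Union>h\<in>maximal_ideal K. {h + a}) = {y \<in> K. absv (y - a) \<le> absv \<pi>}" if "a \<in> K" for a
  proof -
    have "absv z \<le> absv \<pi> \<longleftrightarrow> absv z < 1" if "z \<in> K" for z
      using uniformizerD(3,4) that by fastforce
    then have eq: "{y \<in> K. absv (y - a) \<le> absv \<pi>} = {y \<in> K. absv (y - a) < 1}"
      using K_closed(6)[OF _ \<open>a \<in> K\<close>] by blast
    show ?thesis
      unfolding eq
    proof (intro equalityI subsetI)
      fix y assume "y \<in> {y \<in> K. absv (y - a) < 1}"
      then have "y - a \<in> maximal_ideal K"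
        using K_closed(6) that by (simp add: maximal_ideal_def)
      then show "y \<in> (\<Union>h\<in>maximal_ideal K. {h + a})"
        by (rule UN_I) simp
    qed (use K_closed(3) that in \<open>auto simp: maximal_ideal_def\<close>)
  qed
  have "carrier (residue_field K) = (\<lambda>a. \<Union>h\<in>maximal_ideal K. {h + a}) ` OK"
    by (auto simp: residue_field_def FactRing_def A_RCOSETS_defs r_coset_def)
  also have "\<dots> = (\<lambda>x. {y \<in> K. absv (y - x) \<le> absv \<pi>}) ` OK"
    by (intro image_cong refl coset) (simp add: integer_ring_def)
  finally show ?thesis by (simp add: residue_index_def)
qed

end

text \<open>Both sides are powers of their values at a uniformizer, so it suffices to compare them at
  \<open>x = p\<close>.\<close>

lemma residue_index_absv:
  assumes n: "n = d * r" and x: "x \<in> OK" "x \<noteq> 0"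
  shows "real (residue_index (absv x)) * absv x ^ r = 1"
proof -
  let ?p = "of_nat p :: 'a"
  obtain \<pi> where \<pi>: "uniformizer \<pi>"
    using uniformizer_exists ..
  define D where "D = real (residue_index (absv \<pi>)) * absv \<pi> ^ r"
  have D: "real (residue_index (absv y)) * absv y ^ r = D ^ k" if "absv y = absv \<pi> ^ k" for y k
  proof -
    have "(absv \<pi> ^ k) ^ r = (absv \<pi> ^ r) ^ k"
      by (simp flip: power_mult add: mult.commute)
    then show ?thesis
      by (simp add: that residue_index_uniformizer_power[OF \<pi>] D_def power_mult_distrib)
  qed
  have "?p \<in> OK" "?p \<noteq> 0"
    using absv_of_nat_le_1 K_closed(10) p_gt_1 by (auto simp: integer_ring_def)
  then obtain e where e: "absv ?p = absv \<pi> ^ e"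
    using absv_eq_uniformizer_power[OF \<pi>] by blast
  have "e \<noteq> 0" using e absv_p_less_1 by (intro notI) simp
  \<comment> \<open>Here the normalisation meets the degree: \<open>absv p ^ r\<close> is
    \<open>p\<close> to the power \<open>- d * r = - n\<close>, which cancels the count
    \<open>p ^ n\<close> of classes modulo \<open>p\<close>.\<close>
  have "absv ?p ^ r = inverse (real p ^ n)"
    using p_gt_1 by (simp add: absv_p n powr_minus powr_realpow power_inverse flip: power_mult)
  then have "D ^ e = 1"
    using D[OF e] p_gt_1 by (simp add: residue_index_p)
  moreover have "D \<ge> 0" by (simp add: D_def)
  ultimately have "D = 1"
    using \<open>e \<noteq> 0\<close> by (metis not_gr_zero power_eq_1_iff power_one power_eq_imp_eq_base zero_le_one)
  then show ?thesis
    using absv_eq_uniformizer_power[OF \<pi> x] D by fastforce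
qed

section \<open>Haar measure of balls\<close>

lemma ball_in_sets:
  assumes "haar_measure_on K \<mu>"
  shows "{y \<in> K. absv (y - a) \<le> t} \<in> sets \<mu>"
proof -
  have "{y \<in> K. absv (y - a) \<le> t} = K \<inter> cball a t"
    by (auto simp: mem_cball dist_absv absv_minus_commute[of a])
  then show ?thesis
    using assms by (auto simp: haar_measure_on_def sets_restrict_space)
qed

text \<open>\<open>OK\<close>, of measure \<open>1\<close>, is the disjoint union of
  \<open>N\<close> translates of the ball, where \<open>N\<close> is the index of the ideal
  generated by \<open>b\<close>; so the measure is \<open>1 / N\<close>, and the index formula
  identifies this with \<open>absv b ^ r\<close>.\<close>

lemma emeasure_ball:
  assumes \<mu>: "haar_measure_on K \<mu>" "emeasure \<mu> OK = 1"
    and n: "n = d * r" and a: "a \<in> K" and b: "b \<in> OK" "b \<noteq> 0"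
  shows "emeasure \<mu> {y \<in> K. absv (y - a) \<le> absv b} = ennreal (absv b ^ r)"
proof -
  define B where "B a = {y \<in> K. absv (y - a) \<le> absv b}" for a
  define m where "m = emeasure \<mu> (B 0)"
  have translate: "emeasure \<mu> (B a) = m" if "a \<in> K" for a
  proof -
    have "(+) a ` B 0 = B a"
    proof (intro equalityI subsetI)
      fix y assume "y \<in> B a"
      then have "y - a \<in> B 0" using K_closed(6) that by (simp add: B_def)
      then have "a + (y - a) \<in> (+) a ` B 0" by (rule imageI)
      then show "y \<in> (+) a ` B 0" by simp
    qed (use K_closed(3) that in \<open>auto simp: B_def\<close>)
    moreover have "emeasure \<mu> ((+) a ` B 0) = emeasure \<mu> (B 0)"
      using \<mu>(1) that ball_in_sets[OF \<mu>(1)] unfolding haar_measure_on_def B_def by blast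
    ultimately show ?thesis by (simp add: m_def)
  qed
  obtain R where R: "transversal (absv b) R"
    using transversal_exists by (meson absv_nonneg)
  have RO: "R \<subseteq> OK" using R by (simp add: transversal_def)
  define N where "N = card R"
  have N: "real N * absv b ^ r = 1"
    using residue_index_absv[OF n b] card_transversal[OF R] by (simp add: N_def)
  then have "N > 0" by (intro gr0I) simp
  then have "finite R" by (simp add: N_def card_ge_0_finite)
  have "OK = (\<Union>y\<in>R. B y)"
  proof (intro equalityI subsetI)
    fix x assume x: "x \<in> OK"
    then obtain y where "y \<in> R" "absv (x - y) \<le> absv b" by (rule transversalD[OF R])
    then show "x \<in> (\<Union>y\<in>R. B y)" using x by (auto simp: B_def integer_ring_def)
  next
    fix x assume "x \<in> (\<Union>y\<in>R. B y)"
    then obtain y where y: "y \<in> R" "x \<in> K" "absv (x - y) \<le> absv b" by (auto simp: B_def)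
    have "absv (x - y) \<le> 1" "absv y \<le> 1"
      using y b RO by (auto simp: integer_ring_def)
    then have "absv x \<le> 1" using absv_add_le[of "x - y" y] by simp
    then show "x \<in> OK" using y by (simp add: integer_ring_def)
  qed
  moreover have disj: "disjoint_family_on B R"
    unfolding disjoint_family_on_def
  proof (intro ballI impI)
    fix y z assume yz: "y \<in> R" "z \<in> R" "y \<noteq> z"
    have False if "x \<in> B y" "x \<in> B z" for x
    proof -
      have "absv (y - z) \<le> absv b"
        using absv_diff_trans[of y x "absv b" z] that absv_minus_commute[of x y] by (simp add: B_def)
      then show False
        using transversal_unique[OF R, of y y z] yz RO by auto
    qed
    then show "B y \<inter> B z = {}" by blast
  qed
  moreover have "B ` R \<subseteq> sets \<mu>" using ball_in_sets[OF \<mu>(1)] by (auto simp: B_def)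
  ultimately have "(\<Sum>y\<in>R. emeasure \<mu> (B y)) = 1"
    using sum_emeasure[of B R \<mu>] \<open>finite R\<close> \<mu>(2) by simp
  moreover have "(\<Sum>y\<in>R. emeasure \<mu> (B y)) = (\<Sum>y\<in>R. m)"
    using RO by (intro sum.cong refl translate) (auto simp: integer_ring_def)
  ultimately have Nm: "of_nat N * m = 1"
    by (simp add: N_def)
  have "m \<noteq> \<infinity>"
    using Nm \<open>N > 0\<close> by (intro notI) (simp add: ennreal_mult_top)
  then obtain m' where m': "m' \<ge> 0" "m = ennreal m'"
    by (cases m) auto
  have "ennreal (real N * m') = 1"
    using Nm m' by (simp add: ennreal_mult ennreal_of_nat_eq_real_of_nat)
  then have "real N * m' = 1"
    using m'(1) by (simp add: ennreal_eq_1)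
  then have "m' = absv b ^ r"
    using N \<open>N > 0\<close> by (metis mult_left_cancel of_nat_0_less_iff less_irrefl)
  then show ?thesis
    using translate[OF a] m' by (simp add: B_def)
qed

section \<open>Strictly differentiable functions\<close>

lemma strict_derivativeD:
  assumes "has_strict_derivative_on f f' U" "a \<in> U" "e > 0"
  obtains \<delta> where "\<delta> > 0" "\<And>x y. \<lbrakk>x \<in> U; y \<in> U; x \<noteq> y; dist x a < \<delta>; dist y a < \<delta>\<rbrakk> \<Longrightarrow>
    absv ((f x - f y) / (x - y) - f' a) < e"
proof -
  have "\<forall>\<^sub>F z in at (a, a) within {(x, y). x \<in> U \<and> y \<in> U \<and> x \<noteq> y}.
      dist (case z of (x, y) \<Rightarrow> (f x - f y) / (x - y)) (f' a) < e"
    using assms unfolding has_strict_derivative_on_def by (intro tendstoD) auto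
  then obtain \<delta> where \<delta>: "\<delta> > 0" "\<And>z. \<lbrakk>z \<in> {(x, y). x \<in> U \<and> y \<in> U \<and> x \<noteq> y}; z \<noteq> (a, a);
      dist z (a, a) < \<delta>\<rbrakk> \<Longrightarrow> dist (case z of (x, y) \<Rightarrow> (f x - f y) / (x - y)) (f' a) < e"
    unfolding eventually_at by blast
  show thesis
  proof (rule that)
    \<comment> \<open>The distance of pairs is at most the sum of the two coordinate distances,
      hence the half.\<close>
    show "\<delta> / 2 > 0" using \<delta>(1) by simp
    fix x y assume xy: "x \<in> U" "y \<in> U" "x \<noteq> y" "dist x a < \<delta> / 2" "dist y a < \<delta> / 2"
    have "dist (x, y) (a, a) \<le> dist x a + dist y a"
      unfolding dist_prod_def by (simp add: sqrt_sum_squares_le_sum)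
    then have "dist (x, y) (a, a) < \<delta>" using xy by linarith
    then show "absv ((f x - f y) / (x - y) - f' a) < e"
      using \<delta>(2)[of "(x, y)"] xy by (auto simp: dist_absv)
  qed
qed

lemma absv_small_in_nonzero:
  assumes "e > 0"
  obtains z where "z \<in> K" "z \<noteq> 0" "absv z < e"
proof -
  obtain k where "absv (of_nat p :: 'a) ^ k < e"
    using real_arch_pow_inv[OF assms absv_p_less_1] by blast
  then show thesis
    using that[of "of_nat p ^ k"] p_gt_1 K_closed by (simp add: absv_power)
qed

context
  fixes f f' :: "'a \<Rightarrow> 'a" and U :: "'a set"
  assumes U: "openin (top_of_set K) U" and f: "f \<in> U \<rightarrow> K"
    and deriv: "has_strict_derivative_on f f' U"
begin

lemma U_ball:
  assumes "a \<in> U"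
  obtains \<delta> where "\<delta> > 0" "\<And>x. x \<in> K \<Longrightarrow> dist x a < \<delta> \<Longrightarrow> x \<in> U"
  using U assms unfolding openin_euclidean_subtopology_iff by blast

text \<open>No point of \<open>U\<close> is isolated. At an isolated point the limit defining
  \<open>f'\<close> would be vacuous and would carry no information.\<close>

lemma near_point_in_U:
  assumes "a \<in> U" "e > 0"
  obtains y where "y \<in> U" "y \<noteq> a" "dist y a < e"
proof -
  obtain \<delta> where \<delta>: "\<delta> > 0" "\<And>x. x \<in> K \<Longrightarrow> dist x a < \<delta> \<Longrightarrow> x \<in> U"
    using U_ball assms by blast
  have "a \<in> K" using U assms openin_imp_subset by blast
  obtain z where "z \<in> K" "z \<noteq> 0" "absv z < min \<delta> e"
    using absv_small_in_nonzero[of "min \<delta> e"] \<delta>(1) assms(2) by auto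
  then show thesis
    using that[of "a + z"] \<delta>(2)[of "a + z"] \<open>a \<in> K\<close> K_closed(3) by (simp add: dist_absv)
qed

text \<open>Difference quotients near \<open>a\<close> are bounded by
  \<open>absv (f' a) + 1\<close>, where \<open>1\<close> is the tolerance chosen for the limit.
  Within distance \<open>absv (f a) / M\<close> the function thus moves by less than
  \<open>absv (f a)\<close>, too little to change its absolute value.\<close>

lemma locally_constant_absv:
  assumes a: "a \<in> U" "f a \<noteq> 0"
  obtains \<delta> where "\<delta> > 0" "\<And>x. x \<in> U \<Longrightarrow> dist x a < \<delta> \<Longrightarrow> absv (f x) = absv (f a)"
proof -
  obtain \<delta> where \<delta>: "\<delta> > 0" "\<And>x y. \<lbrakk>x \<in> U; y \<in> U; x \<noteq> y; dist x a < \<delta>; dist y a < \<delta>\<rbrakk> \<Longrightarrow>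
      absv ((f x - f y) / (x - y) - f' a) < 1"
    by (rule strict_derivativeD[OF deriv a(1), of 1]) auto
  define M where "M = absv (f' a) + 1"
  have M: "M > 0" by (simp add: M_def add_nonneg_pos)
  show thesis
  proof (rule that)
    show "min \<delta> (absv (f a) / M) > 0" using \<delta>(1) a(2) M by simp
    fix x assume x: "x \<in> U" "dist x a < min \<delta> (absv (f a) / M)"
    show "absv (f x) = absv (f a)"
    proof (cases "x = a")
      case False
      define q where "q = (f x - f a) / (x - a)"
      have "absv (q - f' a) < 1"
        using \<delta>(2)[of x a] x a(1) \<delta>(1) False by (simp add: q_def)
      then have "absv q \<le> M"
        using absv_triangle[of "q - f' a" "f' a"] by (simp add: M_def)
      moreover have "f x - f a = q * (x - a)" using False by (simp add: q_def)
      ultimately have "absv (f x - f a) \<le> M * absv (x - a)"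
        by (simp add: absv_mult mult_right_mono)
      also have "\<dots> < absv (f a)"
        using x(2) M by (simp add: dist_absv field_simps)
      finally show ?thesis by (rule absv_eq_if_close)
    qed simp
  qed
qed

text \<open>The ultrametric inequality turns a nonzero strict derivative into an exact local scaling.\<close>

lemma locally_scaling:
  assumes a: "a \<in> U" "f' a \<noteq> 0"
  obtains \<delta> where "\<delta> > 0"
    "\<And>x y. \<lbrakk>x \<in> U; y \<in> U; dist x a < \<delta>; dist y a < \<delta>\<rbrakk> \<Longrightarrow> absv (f x - f y) = absv (f' a) * absv (x - y)"
    "\<And>x. \<lbrakk>x \<in> U; dist x a < \<delta>\<rbrakk> \<Longrightarrow> absv (f' x) = absv (f' a)"
proof -
  obtain \<delta> where \<delta>: "\<delta> > 0" "\<And>x y. \<lbrakk>x \<in> U; y \<in> U; x \<noteq> y; dist x a < \<delta>; dist y a < \<delta>\<rbrakk> \<Longrightarrow>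
      absv ((f x - f y) / (x - y) - f' a) < absv (f' a)"
    by (rule strict_derivativeD[OF deriv a(1), of "absv (f' a)"]) (use a in auto)
  have slope: "absv ((f x - f y) / (x - y)) = absv (f' a)"
    if "x \<in> U" "y \<in> U" "x \<noteq> y" "dist x a < \<delta>" "dist y a < \<delta>" for x y
    using \<delta>(2)[OF that] by (rule absv_eq_if_close)
  show thesis
  proof (rule that[OF \<delta>(1)])
    fix x y assume xy: "x \<in> U" "y \<in> U" "dist x a < \<delta>" "dist y a < \<delta>"
    show "absv (f x - f y) = absv (f' a) * absv (x - y)"
      using slope[OF xy(1,2) _ xy(3,4)] by (cases "x = y") (auto simp: absv_divide field_simps)
  next
    fix x assume x: "x \<in> U" "dist x a < \<delta>"
    \<comment> \<open>A slope between \<open>x\<close> and a nearby \<open>y\<close> links the two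
      derivatives: it has value \<open>absv (f' a)\<close> because both points are near
      \<open>a\<close>, and it differs from \<open>f' x\<close> by less than that because
      \<open>y\<close> is near \<open>x\<close>.\<close>
    obtain \<epsilon> where \<epsilon>: "\<epsilon> > 0" "\<And>y z. \<lbrakk>y \<in> U; z \<in> U; y \<noteq> z; dist y x < \<epsilon>; dist z x < \<epsilon>\<rbrakk> \<Longrightarrow>
        absv ((f y - f z) / (y - z) - f' x) < absv (f' a)"
      by (rule strict_derivativeD[OF deriv x(1), of "absv (f' a)"]) (use a in auto)
    obtain y where y: "y \<in> U" "y \<noteq> x" "dist y x < min \<epsilon> (\<delta> - dist x a)"
      by (rule near_point_in_U[OF x(1), of "min \<epsilon> (\<delta> - dist x a)"]) (use x(2) \<epsilon>(1) in auto)
    have ya: "dist y a < \<delta>"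
      using dist_triangle[of y a x] y(3) by simp
    define q where "q = (f y - f x) / (y - x)"
    have "absv q = absv (f' a)"
      unfolding q_def using y x ya by (intro slope) auto
    moreover have "absv (q - f' x) < absv (f' a)"
      unfolding q_def using y x \<epsilon>(1) by (intro \<epsilon>(2)) auto
    ultimately have "absv (f' x) = absv q"
      by (intro absv_eq_if_close) (simp add: absv_minus_commute)
    then show "absv (f' x) = absv (f' a)" using \<open>absv q = absv (f' a)\<close> by simp
  qed
qed

text \<open>The type of \<open>f'\<close> places its values only in the ambient field, while balls
  of known measure have radii that are values of elements of \<open>K\<close>. A difference quotient
  of \<open>f\<close> lies in \<open>K\<close> and has the same value as
  \<open>f' a\<close>.\<close>

lemma absv_derivative_in_value_group:
  assumes a: "a \<in> U"
  shows "\<exists>b\<in>K. absv b = absv (f' a)"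
proof (cases "f' a = 0")
  case False
  obtain \<delta> where \<delta>: "\<delta> > 0"
    "\<And>x y. \<lbrakk>x \<in> U; y \<in> U; dist x a < \<delta>; dist y a < \<delta>\<rbrakk> \<Longrightarrow> absv (f x - f y) = absv (f' a) * absv (x - y)"
    using locally_scaling[OF a False] by metis
  obtain y where y: "y \<in> U" "y \<noteq> a" "dist y a < \<delta>"
    using near_point_in_U[OF a \<delta>(1)] by blast
  have "absv ((f y - f a) / (y - a)) = absv (f' a)"
    using \<delta>(2)[of y a] y a \<delta>(1) by (simp add: absv_divide)
  moreover have "U \<subseteq> K" using U openin_imp_subset by blast
  moreover have "f y \<in> K" "f a \<in> K" using f y(1) a by auto
  ultimately show ?thesis
    using y(1) a K_closed(6,8) by (metis subsetD)
qed (use K_closed(1) in force)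

end

section \<open>Counting zeros\<close>

text \<open>The element \<open>\<pi>\<close> is to be a uniformizer of \<open>F\<close>, not
  necessarily of \<open>K\<close>; its powers put every \<open>q ^ -s\<close> into the value group
  of \<open>K\<close>.\<close>

lemma card_zeros_limit:
  fixes f f' :: "'a \<Rightarrow> 'a" and q r :: nat
  assumes \<mu>: "haar_measure_on K \<mu>" "emeasure \<mu> OK = 1" and n: "n = d * r"
    and \<pi>: "\<pi> \<in> K" "absv \<pi> = 1 / real q" and q: "q > 1"
    and U: "compact U" "openin (top_of_set K) U" and f: "f \<in> U \<rightarrow> K"
    and deriv: "has_strict_derivative_on f f' U"
    and nz: "\<forall>x\<in>U. (f x, f' x) \<noteq> (0, 0)"
  shows "finite {x \<in> U. f x = 0} \<and>
    (\<lambda>s::nat. real q ^ (s * r) *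
       (LINT x:U|\<mu>. absv (f' x) ^ r *
          indicator {x. absv (f x) \<le> real q powr (- real s)} x))
      \<longlonglongrightarrow> real (card {x \<in> U. f x = 0})"
proof
  define Z where "Z = {x \<in> U. f x = 0}"
  have UK: "U \<subseteq> K" using U(2) openin_imp_subset by blast
  have f'_nz: "f' a \<noteq> 0" if "a \<in> Z" for a
    using nz that by (auto simp: Z_def)
  \<comment> \<open>At a zero the condition ranges over \<open>K\<close> and includes membership in
    \<open>U\<close>, so that the set cut out near \<open>a\<close> is a full ball of
    \<open>K\<close>.\<close>
  define P where "P a \<delta> \<longleftrightarrow> \<delta> > 0 \<and>
      (f a \<noteq> 0 \<longrightarrow> (\<forall>x\<in>U. dist x a < \<delta> \<longrightarrow> absv (f x) = absv (f a))) \<and>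
      (f a = 0 \<longrightarrow> (\<forall>x\<in>K. dist x a < \<delta> \<longrightarrow>
         x \<in> U \<and> absv (f x) = absv (f' a) * absv (x - a) \<and> absv (f' x) = absv (f' a)))" for a \<delta>
  have "\<exists>\<delta>. P a \<delta>" if a: "a \<in> U" for a
  proof (cases "f a = 0")
    case False
    then obtain \<delta> where "\<delta> > 0" "\<And>x. x \<in> U \<Longrightarrow> dist x a < \<delta> \<Longrightarrow> absv (f x) = absv (f a)"
      using locally_constant_absv[OF U(2) f deriv a] by metis
    with False have "P a \<delta>" by (simp add: P_def)
    then show ?thesis ..
  next
    case True
    with a have "f' a \<noteq> 0" using f'_nz by (simp add: Z_def)
    then obtain \<delta> where \<delta>: "\<delta> > 0"
      "\<And>x y. \<lbrakk>x \<in> U; y \<in> U; dist x a < \<delta>; dist y a < \<delta>\<rbrakk> \<Longrightarrow> absv (f x - f y) = absv (f' a) * absv (x - y)"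
      "\<And>x. \<lbrakk>x \<in> U; dist x a < \<delta>\<rbrakk> \<Longrightarrow> absv (f' x) = absv (f' a)"
      using locally_scaling[OF U(2) f deriv a] by metis
    obtain \<epsilon> where \<epsilon>: "\<epsilon> > 0" "\<And>x. x \<in> K \<Longrightarrow> dist x a < \<epsilon> \<Longrightarrow> x \<in> U"
      using U_ball[OF U(2) f deriv a] by metis
    have "x \<in> U \<and> absv (f x) = absv (f' a) * absv (x - a) \<and> absv (f' x) = absv (f' a)"
      if "x \<in> K" "dist x a < min \<delta> \<epsilon>" for x
      using \<epsilon>(2)[of x] \<delta>(2)[of x a] \<delta>(3)[of x] a True \<delta>(1) that by simp
    then have "P a (min \<delta> \<epsilon>)"
      using \<delta>(1) \<epsilon>(1) True by (simp add: P_def)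
    then show ?thesis ..
  qed
  then have "\<exists>\<delta>. \<forall>a\<in>U. P a (\<delta> a)"
    by (intro bchoice ballI)
  then obtain \<delta> where P: "\<And>a. a \<in> U \<Longrightarrow> P a (\<delta> a)" by blast
  have \<delta>_pos: "\<delta> a > 0" if "a \<in> U" for a
    using P[OF that] unfolding P_def by blast
  have near_nonzero: "absv (f x) = absv (f a)" if "a \<in> U" "f a \<noteq> 0" "x \<in> U" "dist x a < \<delta> a" for a x
    using P[OF that(1)] that unfolding P_def by blast
  have near_zero: "x \<in> U \<and> absv (f x) = absv (f' a) * absv (x - a) \<and> absv (f' x) = absv (f' a)"
    if "a \<in> Z" "x \<in> K" "dist x a < \<delta> a" for a x
    using P[of a] that unfolding P_def Z_def by blast
  have "U \<subseteq> (\<Union>a\<in>U. ball a (\<delta> a))"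
    using \<delta>_pos by force
  then obtain T where T: "T \<subseteq> U" "finite T" "U \<subseteq> (\<Union>a\<in>T. ball a (\<delta> a))"
    using compactE_image[OF U(1), of U "\<lambda>a. ball a (\<delta> a)"] by auto
  have cover: "\<exists>a\<in>T. dist x a < \<delta> a" if "x \<in> U" for x
    using subsetD[OF T(3) that] by (auto simp: dist_commute)
  \<comment> \<open>A zero covered by the ball around \<open>a\<close> forces
    \<open>f a = 0\<close>, and then the scaling leaves \<open>a\<close> as the only zero in its
    ball. So every zero is one of the finitely many centres.\<close>
  have "Z \<subseteq> T"
  proof
    fix z assume z: "z \<in> Z"
    then obtain a where a: "a \<in> T" "dist z a < \<delta> a" using cover by (auto simp: Z_def)
    have "f a = 0"
      using near_nonzero[of a z] a T(1) z by (auto simp: Z_def)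
    then have "a \<in> Z" using a T(1) by (auto simp: Z_def)
    then have "absv (f z) = absv (f' a) * absv (z - a)"
      using near_zero[of a z] a(2) z UK by (auto simp: Z_def)
    then have "z = a" using z f'_nz[OF \<open>a \<in> Z\<close>] by (simp add: Z_def)
    with a show "z \<in> T" by simp
  qed
  then have finZ: "finite Z" using T(2) finite_subset by blast
  then show "finite {x \<in> U. f x = 0}" by (simp add: Z_def)
  define Q where "Q s = real q powr (- real s)" for s :: nat
  have Q_eq: "Q s = (1 / real q) ^ s" for s
    using q by (simp add: Q_def powr_minus powr_realpow power_divide inverse_eq_divide)
  have Q_pos: "Q s > 0" for s using q by (simp add: Q_def)
  have "Q \<longlonglongrightarrow> 0"
    unfolding Q_eq using q by (intro LIMSEQ_power_zero) simp
  then have Q_small: "\<forall>\<^sub>F s in sequentially. Q s < e" if "e > 0" for e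
    using order_tendstoD(2) that by blast
  \<comment> \<open>The three thresholds exclude the neighbourhoods of centres that are not zeros,
    place the ball \<open>B a\<close> inside the radius \<open>\<delta> a\<close> where scaling
    holds, and keep its radius at most \<open>1\<close> so that it is the value of an element of
    \<open>OK\<close>.\<close>
  have "\<forall>\<^sub>F s in sequentially. (\<forall>a\<in>T - Z. Q s < absv (f a)) \<and>
      (\<forall>a\<in>Z. Q s < absv (f' a) * \<delta> a) \<and> (\<forall>a\<in>Z. Q s < absv (f' a))"
    using T finZ f'_nz \<delta>_pos
    by (intro eventually_conj eventually_ball_finite ballI Q_small) (auto simp: Z_def)
  then have "\<forall>\<^sub>F s in sequentially. real q ^ (s * r) *
       (LINT x:U|\<mu>. absv (f' x) ^ r * indicator {x. absv (f x) \<le> Q s} x) = real (card Z)"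
  proof eventually_elim
    case (elim s)
    define B where "B a = {y \<in> K. absv (y - a) \<le> Q s / absv (f' a)}" for a
    have ZK: "a \<in> K" "a \<in> U" if "a \<in> Z" for a using that UK by (auto simp: Z_def)
    have BD: "x \<in> K" "dist x a < \<delta> a" "x \<in> U" "absv (f x) \<le> Q s" "absv (f' x) = absv (f' a)"
      if "a \<in> Z" "x \<in> B a" for a x
    proof -
      have pos: "absv (f' a) > 0" using f'_nz that by simp
      show x: "x \<in> K" using that by (simp add: B_def)
      have le: "absv (x - a) \<le> Q s / absv (f' a)" using that by (simp add: B_def)
      also have "\<dots> < \<delta> a" using elim that(1) pos by (simp add: field_simps)
      finally show less: "dist x a < \<delta> a" by (simp add: dist_absv)
      show "x \<in> U" "absv (f' x) = absv (f' a)"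
        using near_zero[OF that(1) x less] by auto
      show "absv (f x) \<le> Q s"
        using near_zero[OF that(1) x less] le pos by (simp add: field_simps)
    qed
    \<comment> \<open>If two such balls met, the ultrametric inequality would put the zero with the
      smaller \<open>\<delta>\<close> within the scaling neighbourhood of the other, where the
      centre is the only zero.\<close>
    have disj: "a = b" if ab: "a \<in> Z" "b \<in> Z" and x: "x \<in> B a" "x \<in> B b" for a b x
    proof -
      have *: "a = b" if ab: "a \<in> Z" "b \<in> Z" and x: "x \<in> B a" "x \<in> B b" and le: "\<delta> a \<le> \<delta> b" for a b
      proof -
        have "absv (a - b) \<le> max (dist x a) (dist x b)"
          using absv_diff_le[of "x - b" "x - a"] by (simp add: dist_absv)
        then have "dist a b < \<delta> b"
          using BD(2)[OF ab(1) x(1)] BD(2)[OF ab(2) x(2)] le by (simp add: dist_absv)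
        then have "absv (f a) = absv (f' b) * absv (a - b)"
          using near_zero[OF ab(2) ZK(1)[OF ab(1)]] by blast
        then show "a = b" using ab f'_nz[OF ab(2)] by (simp add: Z_def)
      qed
      show ?thesis
        using *[OF ab x] *[OF ab(2,1) x(2,1)] by (cases "\<delta> a \<le> \<delta> b") auto
    qed
    have cov: "\<exists>a\<in>Z. x \<in> B a" if x: "x \<in> U" "absv (f x) \<le> Q s" for x
    proof -
      obtain a where a: "a \<in> T" "dist x a < \<delta> a" using cover x by blast
      have "a \<in> Z"
      proof (rule ccontr)
        assume nZ: "a \<notin> Z"
        then have "absv (f x) = absv (f a)"
          using near_nonzero[of a x] a T(1) x(1) by (auto simp: Z_def)
        moreover have "Q s < absv (f a)" using elim nZ a by blast
        ultimately show False using x(2) by simp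
      qed
      moreover have "absv (f x) = absv (f' a) * absv (x - a)"
        using near_zero[OF \<open>a \<in> Z\<close> _ a(2)] x UK by blast
      then have "x \<in> B a"
        using x UK f'_nz[OF \<open>a \<in> Z\<close>] by (auto simp: B_def field_simps)
      ultimately show ?thesis by blast
    qed
    \<comment> \<open>As a finite combination of indicators of balls, the integrand is visibly
      measurable and integrable.\<close>
    have integrand: "indicator U x *\<^sub>R (absv (f' x) ^ r * indicator {x. absv (f x) \<le> Q s} x) =
        (\<Sum>a\<in>Z. absv (f' a) ^ r * indicator (B a) x)" for x
    proof (cases "x \<in> U \<and> absv (f x) \<le> Q s")
      case True
      then obtain a where a: "a \<in> Z" "x \<in> B a" using cov by blast
      have "(\<Sum>b\<in>Z. absv (f' b) ^ r * indicator (B b) x) = (\<Sum>b\<in>Z. if b = a then absv (f' a) ^ r else 0)"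
      proof (intro sum.cong refl)
        fix b assume "b \<in> Z"
        then have "x \<notin> B b" if "b \<noteq> a" using disj[of b a x] a that by blast
        then show "absv (f' b) ^ r * indicator (B b) x = (if b = a then absv (f' a) ^ r else 0)"
          using a(2) by simp
      qed
      also have "\<dots> = absv (f' a) ^ r" using a(1) finZ by simp
      finally show ?thesis using True BD(5)[OF a] by simp
    next
      case False
      then have "\<forall>a\<in>Z. x \<notin> B a" using BD by blast
      with False show ?thesis by (auto simp: indicator_def)
    qed
    have emeasure_B: "emeasure \<mu> (B a) = ennreal ((Q s / absv (f' a)) ^ r)" if a: "a \<in> Z" for a
    proof -
      obtain b where b: "b \<in> K" "absv b = absv (f' a)"
        using absv_derivative_in_value_group[OF U(2) f deriv ZK(2)[OF a]] by blast
      \<comment> \<open>This realises the radius of \<open>B a\<close> as the value of an element of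
        \<open>K\<close>.\<close>
      define c where "c = \<pi> ^ s / b"
      have c: "absv c = Q s / absv (f' a)"
        by (simp add: c_def absv_divide absv_power \<pi>(2) b(2) Q_eq)
      have "Q s \<le> absv (f' a)" using elim a less_imp_le by blast
      then have "absv c \<le> 1" using f'_nz[OF a] by (simp add: c)
      moreover have "c \<in> K" unfolding c_def using \<pi>(1) b(1) by (intro K_closed(8,9))
      ultimately have "c \<in> OK" by (simp add: integer_ring_def)
      moreover have "c \<noteq> 0" using c Q_pos[of s] f'_nz[OF a] by auto
      ultimately show ?thesis
        using emeasure_ball[OF \<mu> n ZK(1)[OF a]] by (simp add: B_def flip: c)
    qed
    have B_sets: "B a \<in> sets \<mu>" for a
      unfolding B_def by (rule ball_in_sets[OF \<mu>(1)])
    have "(LINT x:U|\<mu>. absv (f' x) ^ r * indicator {x. absv (f x) \<le> Q s} x) =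
        (LINT x|\<mu>. (\<Sum>a\<in>Z. absv (f' a) ^ r * indicator (B a) x))"
      unfolding set_lebesgue_integral_def integrand ..
    also have "\<dots> = (\<Sum>a\<in>Z. LINT x|\<mu>. absv (f' a) ^ r * indicator (B a) x)"
      using emeasure_B B_sets
      by (intro Bochner_Integration.integral_sum integrable_mult_right integrable_real_indicator) auto
    also have "\<dots> = (\<Sum>a\<in>Z. absv (f' a) ^ r * measure \<mu> (B a))"
      using B_sets sets.sets_into_space[OF B_sets] by (simp add: Int_absorb2)
    also have "\<dots> = (\<Sum>a\<in>Z. Q s ^ r)"
    proof (intro sum.cong refl)
      fix a assume a: "a \<in> Z"
      have "measure \<mu> (B a) = (Q s / absv (f' a)) ^ r"
        unfolding measure_def emeasure_B[OF a] using Q_pos[of s] by (simp add: less_imp_le)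
      then show "absv (f' a) ^ r * measure \<mu> (B a) = Q s ^ r"
        using f'_nz[OF a] by (simp add: power_divide)
    qed
    finally show ?case
      using q by (simp add: Q_eq power_divide flip: power_mult)
  qed
  then have "(\<lambda>s. real q ^ (s * r) *
       (LINT x:U|\<mu>. absv (f' x) ^ r * indicator {x. absv (f x) \<le> Q s} x)) \<longlonglongrightarrow> real (card Z)"
    by (rule tendsto_eventually)
  then show "(\<lambda>s::nat. real q ^ (s * r) *
       (LINT x:U|\<mu>. absv (f' x) ^ r *
          indicator {x. absv (f x) \<le> real q powr (- real s)} x))
      \<longlonglongrightarrow> real (card {x \<in> U. f x = 0})"
    by (simp add: Q_def Z_def)
qed

end

theorem theorem1p1:
  fixes p q d r :: nat
    and Qp F K U :: "'a::abs_valued_field set"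
    and \<mu> :: "'a measure"
    and f f' :: "'a \<Rightarrow> 'a"
  assumes "Factorial_Ring.prime p"
    and "padic_numbers p Qp"
    and "finite_extension_degree Qp F d"
    and "card (carrier (residue_field F)) = q"
    and "algebraic_closure (ambient :: 'a ring) F"
    and "absv (of_nat p :: 'a) = real p powr (- real d)"
    and "finite_extension_degree F K r"
    and "haar_measure_on K \<mu>" and "emeasure \<mu> (integer_ring K) = 1"
    and "U \<subseteq> K" and "compact U" and "openin (top_of_set K) U"
    and "f \<in> U \<rightarrow> K"
    and "has_strict_derivative_on f f' U"
    and "\<forall>x\<in>U. (f x, f' x) \<noteq> (0, 0)"
  shows "finite {x \<in> U. f x = 0} \<and>
    (\<lambda>s::nat. real q ^ (s * r) *
       (LINT x:U|\<mu>. absv (f' x) ^ r *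
          indicator {x. absv (f x) \<le> real q powr (- real s)} x))
      \<longlonglongrightarrow> real (card {x \<in> U. f x = 0})"
proof -
  interpret R: ring "ambient :: 'a ring" by rule
  have F: "subfield Qp ambient" "subfield F ambient" "Qp \<subseteq> F" "R.dimension d Qp F"
    and K: "subfield K ambient" "F \<subseteq> K" "R.dimension r F K"
    using assms(3,7) by (auto simp: finite_extension_degree_def)
  interpret padic_field p d Qp
    using assms(1,2,6) by unfold_locales
  interpret F: padic_extension p d Qp F d
    using F by (intro padic_extension.intro padic_extension_axioms.intro padic_field_axioms)
  \<comment> \<open>The tower law gives the degree \<open>d * r\<close>, while the normalising
    exponent is still the degree \<open>d\<close> of \<open>F\<close>.\<close>
  interpret K: padic_extension p d Qp K "d * r"
    using F(3) K R.telescopic_base[OF F(1,2,4) K(3)]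
    by (intro padic_extension.intro padic_extension_axioms.intro padic_field_axioms) auto
  obtain \<pi> where \<pi>: "F.uniformizer \<pi>"
    using F.uniformizer_exists ..
  have "\<pi> \<in> integer_ring F"
    using F.uniformizerD[OF \<pi>] by (simp add: integer_ring_def)
  \<comment> \<open>The index formula for \<open>F\<close> over itself, with exponent
    \<open>1\<close>: the index of the maximal ideal is \<open>q\<close>.\<close>
  then have "real q * absv \<pi> = 1"
    using F.residue_index_absv[of 1 \<pi>] F.uniformizerD(2)[OF \<pi>] F.card_residue_field[OF \<pi>] assms(4)
    by simp
  then have q: "absv \<pi> = 1 / real q"
    by (metis nonzero_eq_divide_eq mult.commute mult_zero_left zero_neq_one)
  moreover have "0 < absv \<pi>" "absv \<pi> < 1"
    using F.uniformizerD(2,3)[OF \<pi>] by auto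
  \<comment> \<open>For \<open>q = 0\<close> the quotient \<open>1 / real q\<close> takes the
    default value \<open>0\<close>, contradicting \<open>0 < absv \<pi>\<close>; for
    \<open>q = 1\<close> it is \<open>1\<close>.\<close>
  ultimately have "q > 1"
    using q by (cases "q = 0"; cases "q = 1") auto
  then show ?thesis
    using K.card_zeros_limit[OF assms(8,9) refl _ q _ assms(11-15)] F.uniformizerD(1)[OF \<pi>] K(2)
    by blast
qed

end
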